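(* Let $m\ge4$, $k\ge1$, and let $3\le q_1<q_2<\dots<q_k\le m+1$ be integers. Then the Lie algebra $\mathfrak{g}_m(q_1,\dots,q_k)$ is simple completable.
   Context: All Lie algebras are over $\mathbb{C}$. For $m\ge4$ and integers $3\le q_1<\dots<q_k\le m+1$, $\mathfrak{g}_m(q_1,\dots,q_k)$ is the $(2m+1)$-dimensional nilpotent Lie algebra with Maurer–Cartan equations $d\omega_1=d\omega_2=0$; $d\omega_{q_i}=d\omega_{2m+2-q_i}=0$ for $1\le i\le k$; $d\omega_j=\omega_1\wedge\omega_{j-1}$ for $3\le j\le 2m$ with $j\notin\{q_i,2m+2-q_i\}_{1\le i\le k}$; $d\omega_{2m+1}=\sum_{j=2}^{m}(-1)^j\omega_j\wedge\omega_{2m+1-j}$. Here $d\omega_l=\sum_{i<j}C_{ij}^l\,\omega_i\wedge\omega_j$ means $[X_i,X_j]=\sum_l C_{ij}^l X_l$ in the dual basis $\{X_1,\dots,X_{2m+1}\}$ (the opposite overall sign convention gives an isomorphic algebra). A torus over a nilpotent Lie algebra $\mathfrak{g}$ is an abelian subalgebra of $Der(\mathfrak{g})$ consisting of semisimple derivations; it is maximal if it is maximal for inclusion. A Lie algebra is complete if its center is zero and all its derivations are inner. A nilpotent Lie algebra $\mathfrak{g}$ is completable if the semidirect product $\mathfrak{t}\oplus\mathfrak{g}$ (with $\mathfrak{t}$ abelian and $[f,x]=f(x)$ for $f\in\mathfrak{t}$, $x\in\mathfrak{g}$) is complete for a maximal torus $\mathfrak{t}$ over $\mathfrak{g}$.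 It is simple completable if it is completable and is not the direct sum of nontrivial completable Lie algebras. *)

theory Defs
  imports Complex_Main "HOL-Library.Function_Algebras" "HOL-Library.Product_Plus" "HOL-Library.FuncSet"
begin

text \<open>
  Complex Lie algebras are given with an explicit carrier, a subspace of an ambient
  complex vector space (in the sense of the library locale \<^locale>\<open>vector_space\<close>):
  the dimension of the algebras considered depends on a parameter, and the carriers of ideals,
  of algebras of derivations and of semidirect products are not whole types.
\<close>

record 'v lie =
  carr :: "'v set"
  scal :: "complex \<Rightarrow> 'v \<Rightarrow> 'v"
  brk :: "'v \<Rightarrow> 'v \<Rightarrow> 'v"

definition lie_algebra :: "'v::ab_group_add lie \<Rightarrow> bool" where
  "lie_algebra L \<longleftrightarrow>
     vector_space (scal L) \<and> module.subspace (scal L) (carr L) \<and>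
     (\<forall>x\<in>carr L. \<forall>y\<in>carr L. brk L x y \<in> carr L) \<and>
     (\<forall>x\<in>carr L. \<forall>y\<in>carr L. \<forall>z\<in>carr L.
        brk L (x + y) z = brk L x z + brk L y z \<and> brk L x (y + z) = brk L x y + brk L x z) \<and>
     (\<forall>c. \<forall>x\<in>carr L. \<forall>y\<in>carr L.
        brk L (scal L c x) y = scal L c (brk L x y) \<and> brk L x (scal L c y) = scal L c (brk L x y)) \<and>
     (\<forall>x\<in>carr L. brk L x x = 0) \<and>
     (\<forall>x\<in>carr L. \<forall>y\<in>carr L. \<forall>z\<in>carr L.
        brk L x (brk L y z) + brk L y (brk L z x) + brk L z (brk L x y) = 0)"

definition finite_dimensional :: "'v::ab_group_add lie \<Rightarrow> bool" where
  "finite_dimensional L \<longleftrightarrow> (\<exists>B. finite B \<and> module.span (scal L) B = carr L)"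

definition lie_subalgebra :: "'v::ab_group_add lie \<Rightarrow> 'v set \<Rightarrow> bool" where
  "lie_subalgebra L S \<longleftrightarrow> S \<subseteq> carr L \<and> module.subspace (scal L) S \<and>
     (\<forall>x\<in>S. \<forall>y\<in>S. brk L x y \<in> S)"

definition lie_ideal :: "'v::ab_group_add lie \<Rightarrow> 'v set \<Rightarrow> bool" where
  "lie_ideal L I \<longleftrightarrow> I \<subseteq> carr L \<and> module.subspace (scal L) I \<and>
     (\<forall>x\<in>carr L. \<forall>y\<in>I. brk L x y \<in> I)"

fun lower_central :: "'v::ab_group_add lie \<Rightarrow> nat \<Rightarrow> 'v set" where
  "lower_central L 0 = carr L"
| "lower_central L (Suc n) =
     module.span (scal L) {brk L x y | x y. x \<in> carr L \<and> y \<in> lower_central L n}"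

definition nilpotent_lie :: "'v::ab_group_add lie \<Rightarrow> bool" where
  "nilpotent_lie L \<longleftrightarrow> (\<exists>n. lower_central L n = {0})"

definition lie_center :: "'v::ab_group_add lie \<Rightarrow> 'v set" where
  "lie_center L = {x \<in> carr L. \<forall>y\<in>carr L. brk L x y = 0}"

text \<open>
  A linear endomorphism of the carrier is represented by the function on the ambient type that
  is 0 off the carrier, so that equality of endomorphisms is equality of functions.
\<close>

definition lie_endos :: "'v::ab_group_add lie \<Rightarrow> ('v \<Rightarrow> 'v) set" where
  "lie_endos L = {f. (\<forall>x\<in>carr L. f x \<in> carr L) \<and> (\<forall>x. x \<notin> carr L \<longrightarrow> f x = 0) \<and>
     (\<forall>x\<in>carr L. \<forall>y\<in>carr L. f (x + y) = f x + f y) \<and>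
     (\<forall>c. \<forall>x\<in>carr L. f (scal L c x) = scal L c (f x))}"

definition Der :: "'v::ab_group_add lie \<Rightarrow> ('v \<Rightarrow> 'v) lie" where
  "Der L = \<lparr>
     carr = {f \<in> lie_endos L. \<forall>x\<in>carr L. \<forall>y\<in>carr L.
       f (brk L x y) = brk L (f x) y + brk L x (f y)},
     scal = (\<lambda>c f x. scal L c (f x)),
     brk = (\<lambda>f g x. f (g x) - g (f x))\<rparr>"

text \<open>
  Semisimplicity: every invariant subspace has an invariant complement. (In finite dimension
  over the complex numbers this is the same as being diagonalizable.)
\<close>

definition semisimple_endo :: "'v::ab_group_add lie \<Rightarrow> ('v \<Rightarrow> 'v) \<Rightarrow> bool" where
  "semisimple_endo L f \<longleftrightarrow>
     (\<forall>W. W \<subseteq> carr L \<and> module.subspace (scal L) W \<and> f ` W \<subseteq> W \<longrightarrow>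
       (\<exists>U. U \<subseteq> carr L \<and> module.subspace (scal L) U \<and> f ` U \<subseteq> U \<and>
            W \<inter> U = {0} \<and> carr L = {w + u | w u. w \<in> W \<and> u \<in> U}))"

definition lie_torus :: "'v::ab_group_add lie \<Rightarrow> ('v \<Rightarrow> 'v) set \<Rightarrow> bool" where
  "lie_torus L T \<longleftrightarrow> lie_subalgebra (Der L) T \<and>
     (\<forall>f\<in>T. \<forall>g\<in>T. brk (Der L) f g = 0) \<and> (\<forall>f\<in>T. semisimple_endo L f)"

definition maximal_torus :: "'v::ab_group_add lie \<Rightarrow> ('v \<Rightarrow> 'v) set \<Rightarrow> bool" where
  "maximal_torus L T \<longleftrightarrow> lie_torus L T \<and> (\<forall>T'. lie_torus L T' \<and> T \<subseteq> T' \<longrightarrow> T' = T)"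

text \<open>
  The second component of the bracket combines \<open>[f, y] = f y\<close>, \<open>[x, g] = - g x\<close>
  and the bracket of \<open>L\<close>.
\<close>

definition semidirect :: "('v \<Rightarrow> 'v) set \<Rightarrow> 'v::ab_group_add lie \<Rightarrow> (('v \<Rightarrow> 'v) \<times> 'v) lie" where
  "semidirect T L = \<lparr>
     carr = T \<times> carr L,
     scal = (\<lambda>c (f, x). (scal (Der L) c f, scal L c x)),
     brk = (\<lambda>(f, x) (g, y). (brk (Der L) f g, f y - g x + brk L x y))\<rparr>"

definition complete_lie :: "'v::ab_group_add lie \<Rightarrow> bool" where
  "complete_lie L \<longleftrightarrow> lie_algebra L \<and> lie_center L = {0} \<and>
     (\<forall>f\<in>carr (Der L). \<exists>x\<in>carr L. \<forall>y\<in>carr L. f y = brk L x y)"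

definition completable :: "'v::ab_group_add lie \<Rightarrow> bool" where
  "completable L \<longleftrightarrow> lie_algebra L \<and> finite_dimensional L \<and> nilpotent_lie L \<and>
     (\<exists>T. maximal_torus L T \<and> complete_lie (semidirect T L))"

definition direct_sum_of_ideals :: "'v::ab_group_add lie \<Rightarrow> nat \<Rightarrow> (nat \<Rightarrow> 'v set) \<Rightarrow> bool" where
  "direct_sum_of_ideals L n I \<longleftrightarrow> (\<forall>i<n. lie_ideal L (I i)) \<and>
     (\<forall>x\<in>carr L. \<exists>!f. f \<in> Pi\<^sub>E {..<n} I \<and> x = (\<Sum>i<n. f i))"

definition simple_completable :: "'v::ab_group_add lie \<Rightarrow> bool" where
  "simple_completable L \<longleftrightarrow> completable L \<and>
     \<not> (\<exists>n I. n \<ge> 2 \<and> direct_sum_of_ideals L n I \<and>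
          (\<forall>i<n. I i \<noteq> {0} \<and> completable (L\<lparr>carr := I i\<rparr>)))"

text \<open>
  A vector \<open>x\<close> is the coordinate function of \<open>\<Sum>i. x i X\<^sub>i\<close>. The value of
  \<open>\<omega>\<^sub>i \<and> \<omega>\<^sub>j\<close> on a pair of vectors is \<open>wedge i j\<close>; since
  \<open>C\<^sub>i\<^sub>j\<^sup>l\<close> is the value of \<open>d\<omega>\<^sub>l\<close> on \<open>(X\<^sub>i, X\<^sub>j)\<close>, the
  l-th coordinate of the bracket is \<open>d\<omega>\<^sub>l\<close>.
\<close>

definition wedge :: "nat \<Rightarrow> nat \<Rightarrow> (nat \<Rightarrow> complex) \<Rightarrow> (nat \<Rightarrow> complex) \<Rightarrow> complex" where
  "wedge i j x y = x i * y j - x j * y i"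

definition d_omega ::
    "nat \<Rightarrow> nat \<Rightarrow> (nat \<Rightarrow> nat) \<Rightarrow> nat \<Rightarrow> (nat \<Rightarrow> complex) \<Rightarrow> (nat \<Rightarrow> complex) \<Rightarrow> complex" where
  "d_omega m k q l x y =
     (if l \<in> q ` {1..k} \<union> (\<lambda>i. 2 * m + 2 - q i) ` {1..k} then 0
      else if 3 \<le> l \<and> l \<le> 2 * m then wedge 1 (l - 1) x y
      else if l = 2 * m + 1 then (\<Sum>j=2..m. (-1) ^ j * wedge j (2 * m + 1 - j) x y)
      else 0)"

definition g_alg :: "nat \<Rightarrow> nat \<Rightarrow> (nat \<Rightarrow> nat) \<Rightarrow> (nat \<Rightarrow> complex) lie" where
  "g_alg m k q = \<lparr>
     carr = {x. \<forall>i. i \<notin> {1..2 * m + 1} \<longrightarrow> x i = 0},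
     scal = (\<lambda>c x i. c * x i),
     brk = (\<lambda>x y l. d_omega m k q l x y)\<rparr>"

end

theory Submission
  imports Defs
begin

text \<open>
  Giving \<open>X\<^sub>i\<close> degree \<open>i\<close> grades the algebra, so \<open>X\<^sub>i \<mapsto> i X\<^sub>i\<close> is a derivation
  \<open>D\<^sub>0\<close> with positive simple spectrum. Whatever commutes with \<open>D\<^sub>0\<close> is diagonal, so the diagonal
  derivations form a maximal torus \<open>T\<close>. A derivation \<open>\<delta>\<close> of \<open>T \<oplus> \<gg>\<close> can be changed by an inner
  one so that \<open>\<delta> D\<^sub>0 \<in> T\<close>; comparing eigenspaces of \<open>D\<^sub>0\<close> then shows that \<open>\<delta>\<close> is the inner
  derivation of an element of \<open>T\<close>.

  If \<open>\<gg> = A \<oplus> B\<close> with \<open>[A, B] = 0\<close>, then the coordinates of the bracket along \<open>X\<^sub>2\<^sub>m\<close>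
  (a form of rank 2) and along \<open>X\<^sub>2\<^sub>m\<^sub>+\<^sub>1\<close> (nondegenerate on the span of \<open>X\<^sub>2, \<dots>, X\<^sub>2\<^sub>m\<^sub>-\<^sub>1\<close>)
  force one summand into the center \<open>\<langle>X\<^sub>2\<^sub>m, X\<^sub>2\<^sub>m\<^sub>+\<^sub>1\<rangle>\<close>, which lies in the derived algebra and
  hence in the other summand.
\<close>

section \<open>Derivations and semidirect products\<close>

lemma lie_algebraD:
  assumes "lie_algebra L"
  shows "vector_space (scal L)" "module (scal L)" "module.subspace (scal L) (carr L)"
    "0 \<in> carr L"
    "\<And>x y. x \<in> carr L \<Longrightarrow> y \<in> carr L \<Longrightarrow> x + y \<in> carr L"
    "\<And>x y. x \<in> carr L \<Longrightarrow> y \<in> carr L \<Longrightarrow> x - y \<in> carr L"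
    "\<And>x. x \<in> carr L \<Longrightarrow> - x \<in> carr L"
    "\<And>c x. x \<in> carr L \<Longrightarrow> scal L c x \<in> carr L"
    "\<And>x y. x \<in> carr L \<Longrightarrow> y \<in> carr L \<Longrightarrow> brk L x y \<in> carr L"
    "\<And>x y z. x \<in> carr L \<Longrightarrow> y \<in> carr L \<Longrightarrow> z \<in> carr L \<Longrightarrow> brk L (x + y) z = brk L x z + brk L y z"
    "\<And>x y z. x \<in> carr L \<Longrightarrow> y \<in> carr L \<Longrightarrow> z \<in> carr L \<Longrightarrow> brk L x (y + z) = brk L x y + brk L x z"
    "\<And>c x y. x \<in> carr L \<Longrightarrow> y \<in> carr L \<Longrightarrow> brk L (scal L c x) y = scal L c (brk L x y)"
    "\<And>c x y. x \<in> carr L \<Longrightarrow> y \<in> carr L \<Longrightarrow> brk L x (scal L c y) = scal L c (brk L x y)"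
    "\<And>x. x \<in> carr L \<Longrightarrow> brk L x x = 0"
    "\<And>x y z. x \<in> carr L \<Longrightarrow> y \<in> carr L \<Longrightarrow> z \<in> carr L \<Longrightarrow>
        brk L x (brk L y z) + brk L y (brk L z x) + brk L z (brk L x y) = 0"
proof -
  show vs: "vector_space (scal L)" and sub: "module.subspace (scal L) (carr L)"
    using assms by (auto simp: lie_algebra_def)
  interpret V: vector_space "scal L" by (rule vs)
  show "module (scal L)" by (rule V.module_axioms)
  show "0 \<in> carr L" "\<And>x y. x \<in> carr L \<Longrightarrow> y \<in> carr L \<Longrightarrow> x + y \<in> carr L"
    "\<And>x y. x \<in> carr L \<Longrightarrow> y \<in> carr L \<Longrightarrow> x - y \<in> carr L"
    "\<And>x. x \<in> carr L \<Longrightarrow> - x \<in> carr L"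
    "\<And>c x. x \<in> carr L \<Longrightarrow> scal L c x \<in> carr L"
    using sub by (auto simp: V.subspace_0 V.subspace_add V.subspace_diff V.subspace_neg V.subspace_scale)
qed (use assms in \<open>simp_all add: lie_algebra_def\<close>)

lemma lie_brk_minus:
  assumes "lie_algebra L" "x \<in> carr L" "y \<in> carr L" "z \<in> carr L"
  shows "brk L (x - y) z = brk L x z - brk L y z" "brk L x (y - z) = brk L x y - brk L x z"
proof -
  note L = lie_algebraD[OF assms(1)]
  have "brk L (x - y) z + brk L y z = brk L (x - y + y) z"
    using L(10)[OF L(6)[OF assms(2,3)] assms(3,4)] by simp
  then show "brk L (x - y) z = brk L x z - brk L y z" by (simp add: algebra_simps)
  have "brk L x (y - z) + brk L x z = brk L x (y - z + z)"
    using L(11)[OF assms(2) L(6)[OF assms(3,4)] assms(4)] by simp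
  then show "brk L x (y - z) = brk L x y - brk L x z" by (simp add: algebra_simps)
qed

lemma lie_brk_0:
  assumes "lie_algebra L" "x \<in> carr L"
  shows "brk L 0 x = 0" "brk L x 0 = 0"
  using lie_brk_minus[OF assms(1,2,2,2)] by auto

lemma lie_brk_commute:
  assumes "lie_algebra L" "x \<in> carr L" "y \<in> carr L"
  shows "brk L x y = - brk L y x"
proof -
  note L = lie_algebraD[OF assms(1)]
  have "brk L (x + y) (x + y) = brk L x x + brk L y x + (brk L x y + brk L y y)"
    using assms by (simp add: L(5,10,11))
  then have "brk L x y + brk L y x = 0" using assms by (simp add: L(5,14) add.commute)
  then show ?thesis by (simp add: eq_neg_iff_add_eq_0)
qed

lemma lie_endosD:
  assumes "f \<in> lie_endos L"
  shows "\<And>x. x \<in> carr L \<Longrightarrow> f x \<in> carr L" "\<And>x. x \<notin> carr L \<Longrightarrow> f x = 0"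
    "\<And>x y. x \<in> carr L \<Longrightarrow> y \<in> carr L \<Longrightarrow> f (x + y) = f x + f y"
    "\<And>c x. x \<in> carr L \<Longrightarrow> f (scal L c x) = scal L c (f x)"
  using assms by (auto simp: lie_endos_def)

lemma lie_endos_minus:
  assumes "lie_algebra L" "f \<in> lie_endos L" "x \<in> carr L" "y \<in> carr L"
  shows "f (x - y) = f x - f y"
proof -
  have "f (x - y) + f y = f (x - y + y)"
    using lie_endosD(3)[OF assms(2) lie_algebraD(6)[OF assms(1,3,4)] assms(4)] by simp
  then show ?thesis by (simp add: algebra_simps)
qed

lemma lie_endos_0:
  assumes "lie_algebra L" "f \<in> lie_endos L"
  shows "f 0 = 0"
  using lie_endos_minus[OF assms lie_algebraD(4)[OF assms(1)] lie_algebraD(4)[OF assms(1)]] by simp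

text \<open>Endomorphisms are additive only on the carrier, so the induction has to carry membership
  of the partial sums along.\<close>

lemma lie_endos_sum:
  assumes L: "lie_algebra L" and f: "f \<in> lie_endos L" and "finite A"
    and "\<And>i. i \<in> A \<Longrightarrow> x i \<in> carr L"
  shows "(\<Sum>i\<in>A. x i) \<in> carr L \<and> f (\<Sum>i\<in>A. x i) = (\<Sum>i\<in>A. f (x i))"
  using assms(3,4)
proof (induction A rule: finite_induct)
  case empty
  then show ?case using lie_endos_0[OF L f] lie_algebraD(4)[OF L] by simp
next
  case (insert a A)
  then show ?case using lie_endosD(3)[OF f] lie_algebraD(5)[OF L] by simp
qed

lemma Der_simps:
  "scal (Der L) = (\<lambda>c f x. scal L c (f x))" "brk (Der L) f g = (\<lambda>x. f (g x) - g (f x))"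
  by (simp_all add: Der_def)

lemma DerD:
  assumes "f \<in> carr (Der L)"
  shows "f \<in> lie_endos L"
    "\<And>x y. x \<in> carr L \<Longrightarrow> y \<in> carr L \<Longrightarrow> f (brk L x y) = brk L (f x) y + brk L x (f y)"
  using assms by (auto simp: Der_def)

lemma vector_space_pointwise:
  assumes "vector_space s"
  shows "vector_space (\<lambda>c f x. s c (f x))"
proof -
  interpret vector_space s by fact
  show ?thesis by unfold_locales (auto simp: fun_eq_iff scale_right_distrib scale_left_distrib)
qed

lemma vector_space_pair:
  assumes "vector_space s" "vector_space t"
  shows "vector_space (\<lambda>c (x, y). (s c x, t c y))"
proof -
  interpret S: vector_space s by fact
  interpret T: vector_space t by fact
  show ?thesis
    by unfold_locales
      (auto simp: S.scale_right_distrib S.scale_left_distrib T.scale_right_distrib T.scale_left_distrib)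
qed

text \<open>By the Jacobi identity, bracketing with \<open>a\<close> is a derivation; the cutoff off
  the carrier keeps the difference in \<open>lie_endos L\<close>. This serves to normalize a
  derivation modulo inner ones.\<close>

lemma Der_diff_inner:
  assumes L: "lie_algebra L" and f: "f \<in> carr (Der L)" and a: "a \<in> carr L"
  shows "(\<lambda>p. if p \<in> carr L then f p - brk L a p else 0) \<in> carr (Der L)"
proof -
  note LD = lie_algebraD[OF L] and E = lie_endosD[OF DerD(1)[OF f]]
  interpret V: vector_space "scal L" by (rule LD(1))
  have jac: "brk L a (brk L x y) = brk L (brk L a x) y + brk L x (brk L a y)"
    if "x \<in> carr L" "y \<in> carr L" for x y
  proof -
    have "brk L a (brk L x y) + brk L x (brk L y a) + brk L y (brk L a x) = 0"
      using LD(15) a that by simp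
    moreover have "brk L x (brk L y a) = - brk L x (brk L a y)"
      using lie_brk_commute[OF L that(2) a] lie_brk_minus(2)[OF L that(1) LD(4), of "brk L a y"]
        lie_brk_0[OF L that(1)] LD(9)[OF a that(2)] by simp
    moreover have "brk L y (brk L a x) = - brk L (brk L a x) y"
      using lie_brk_commute[OF L that(2) LD(9)[OF a that(1)]] .
    ultimately show ?thesis by (simp add: algebra_simps)
  qed
  have der: "f (brk L x y) - brk L a (brk L x y) =
      brk L (f x - brk L a x) y + brk L x (f y - brk L a y)"
    if "x \<in> carr L" "y \<in> carr L" for x y
    using that a by (simp add: DerD(2)[OF f] jac lie_brk_minus[OF L] LD E algebra_simps)
  show ?thesis
    using a by (auto simp: Der_def lie_endos_def LD E der algebra_simps V.scale_right_diff_distrib)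
qed

section \<open>Semidirect products with a torus\<close>

lemma semidirect_simps:
  "carr (semidirect T L) = T \<times> carr L"
  "scal (semidirect T L) = (\<lambda>c (f, x). (\<lambda>y. scal L c (f y), scal L c x))"
  "brk (semidirect T L) (f, x) (g, y) = (\<lambda>z. f (g z) - g (f z), f y - g x + brk L x y)"
  by (simp_all add: semidirect_def Der_simps)

text \<open>The torus is abelian, so every bracket has first component 0. In the second component
  the Jacobi identity combines that of \<open>L\<close>, the Leibniz rule for the maps in
  \<open>T\<close>, and the fact that these maps commute.\<close>

lemma lie_algebra_semidirect:
  assumes L: "lie_algebra L" and T: "lie_torus L T"
  shows "lie_algebra (semidirect T L)"
proof -
  note LD = lie_algebraD[OF L]
  interpret V: vector_space "scal L" by (rule LD(1))
  interpret D: vector_space "\<lambda>c f x. scal L c (f x)" by (rule vector_space_pointwise[OF LD(1)])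
  interpret S: vector_space "\<lambda>c (f, x). (\<lambda>y. scal L c (f y), scal L c x)"
    by (rule vector_space_pair[OF D.vector_space_axioms LD(1)])
  have TD: "f \<in> carr (Der L)" if "f \<in> T" for f
    using T that by (auto simp: lie_torus_def lie_subalgebra_def)
  have Tsub: "D.subspace T" using T by (simp add: lie_torus_def lie_subalgebra_def Der_simps)
  have comm0: "(\<lambda>x. f (g x) - g (f x)) = 0" if "f \<in> T" "g \<in> T" for f g
    using T that by (simp add: lie_torus_def Der_simps)
  have comm: "f (g x) = g (f x)" if "f \<in> T" "g \<in> T" for f g x
    using comm0[OF that] by (simp add: fun_eq_iff)
  have E: "f \<in> lie_endos L" if "f \<in> T" for f using DerD(1)[OF TD[OF that]] .
  note ED = lie_endosD[OF E] lie_endos_minus[OF L E] DerD(2)[OF TD]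
  have br: "brk (semidirect T L) (f, x) (g, y) = (0, f y - g x + brk L x y)"
    if "f \<in> T" "g \<in> T" for f g x y
    using comm0[OF that] by (simp add: semidirect_simps)
  have T0: "0 \<in> T" using D.subspace_0[OF Tsub] .
  have sub: "S.subspace (T \<times> carr L)"
    using Tsub LD(3) by (auto simp: S.subspace_def D.subspace_def V.subspace_def zero_prod_def)
  have dbl: "brk (semidirect T L) (f, x) (brk (semidirect T L) (g, y) (h, z)) =
      (0, f (g z) - f (h y) + (brk L (f y) z + brk L y (f z)) + (brk L x (g z) - brk L x (h y) + brk L x (brk L y z)))"
    if "f \<in> T" "g \<in> T" "h \<in> T" "x \<in> carr L" "y \<in> carr L" "z \<in> carr L" for f g h x y z
    using that T0 by (simp add: br LD ED lie_brk_minus[OF L])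
  have jac: "brk (semidirect T L) p (brk (semidirect T L) q r) + brk (semidirect T L) q (brk (semidirect T L) r p)
    + brk (semidirect T L) r (brk (semidirect T L) p q) = 0"
    if "p \<in> T \<times> carr L" "q \<in> T \<times> carr L" "r \<in> T \<times> carr L" for p q r
  proof -
    obtain f x g y h z where p: "p = (f, x)" "q = (g, y)" "r = (h, z)"
      and m: "f \<in> T" "g \<in> T" "h \<in> T" "x \<in> carr L" "y \<in> carr L" "z \<in> carr L"
      using \<open>p \<in> _\<close> \<open>q \<in> _\<close> \<open>r \<in> _\<close> by auto
    have J: "brk L x (brk L y z) = - brk L y (brk L z x) - brk L z (brk L x y)"
      using LD(15)[OF m(4-6)] by (simp add: eq_diff_eq eq_neg_iff_add_eq_0 ac_simps)
    \<comment> \<open>Antisymmetry brings matching mixed brackets into the same orientation, so that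
      they cancel.\<close>
    have c: "brk L (h y) x = - brk L x (h y)" "brk L (f z) y = - brk L y (f z)"
       "brk L (g x) z = - brk L z (g x)" "brk L y (h x) = - brk L (h x) y" 
       "brk L z (f y) = - brk L (f y) z" "brk L x (g z) = - brk L (g z) x"
      by (rule lie_brk_commute[OF L]; simp add: m ED(1))+
    show ?thesis
      unfolding p dbl[OF m] dbl[OF m(2,3,1) m(5,6,4)] dbl[OF m(3,1,2) m(6,4,5)]
      by (simp add: zero_prod_def J c comm[OF m(2,1)] comm[OF m(3,1)] comm[OF m(3,2)])
  qed
  show ?thesis
    unfolding lie_algebra_def semidirect_simps(1,2)
  proof (intro conjI ballI allI)
    show "vector_space (\<lambda>c (f, x). (\<lambda>y. scal L c (f y), scal L c x))" by (rule S.vector_space_axioms)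
  qed (use sub T0 D.subspace_add[OF Tsub] D.subspace_scale[OF Tsub] jac in
      \<open>auto simp: br LD ED zero_prod_def zero_fun_def[symmetric] algebra_simps V.scale_right_distrib V.scale_right_diff_distrib\<close>)
qed

section \<open>Algebras graded by the index of the basis vectors\<close>

lemma sum_fun_apply: "(\<Sum>i\<in>A. f i) x = (\<Sum>i\<in>A. f i x)"
  for f :: "'a \<Rightarrow> 'b \<Rightarrow> 'c::comm_monoid_add"
  by (induction A rule: infinite_finite_induct) auto

section \<open>Coordinates, and semisimplicity of diagonal maps\<close>

definition unit_vec :: "nat \<Rightarrow> nat \<Rightarrow> complex" where
  "unit_vec i = (\<lambda>j. if j = i then 1 else 0)"

definition weight_op :: "(nat \<Rightarrow> complex) \<Rightarrow> nat \<Rightarrow> complex" where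
  "weight_op x = (\<lambda>i. of_nat i * x i)"

definition diagonal_ders :: "(nat \<Rightarrow> complex) lie \<Rightarrow> ((nat \<Rightarrow> complex) \<Rightarrow> nat \<Rightarrow> complex) set" where
  "diagonal_ders L = {f \<in> carr (Der L). \<exists>d. \<forall>x\<in>carr L. f x = (\<lambda>i. d i * x i)}"

text \<open>All that completability requires besides nilpotency: the index is a grading of the
  bracket. The weights 1, ..., n are distinct, so maps commuting with \<open>weight_op\<close> are
  diagonal, and nonzero, so \<open>weight_op\<close> is invertible on the carrier.\<close>

locale weighted_lie =
  fixes n :: nat and L :: "(nat \<Rightarrow> complex) lie"
  assumes carr_eq: "carr L = {x. \<forall>i. i \<notin> {1..n} \<longrightarrow> x i = 0}"
    and scal_eq: "scal L = (\<lambda>c x i. c * x i)"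
    and lie: "lie_algebra L"
    and weight_op_brk: "\<And>x y. x \<in> carr L \<Longrightarrow> y \<in> carr L \<Longrightarrow>
      weight_op (brk L x y) = brk L (weight_op x) y + brk L x (weight_op y)"
begin

sublocale V: vector_space "scal L"
  by (rule lie_algebraD(1)[OF lie])

lemma unit_vec_carr: "i \<in> {1..n} \<Longrightarrow> unit_vec i \<in> carr L"
  by (auto simp: carr_eq unit_vec_def)

lemma weight_op_carr: "x \<in> carr L \<Longrightarrow> weight_op x \<in> carr L"
  by (auto simp: carr_eq weight_op_def)

lemma coord_expansion:
  assumes "x \<in> carr L"
  shows "x = (\<Sum>i\<in>{1..n}. scal L (x i) (unit_vec i))"
proof
  fix j
  have "(\<Sum>i\<in>{1..n}. scal L (x i) (unit_vec i)) j = (\<Sum>i\<in>{1..n}. if i = j then x i else 0)"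
    unfolding sum_fun_apply by (rule sum.cong) (auto simp: scal_eq unit_vec_def)
  also have "\<dots> = x j" using assms by (auto simp: carr_eq)
  finally show "x j = (\<Sum>i\<in>{1..n}. scal L (x i) (unit_vec i)) j" by simp
qed

lemma finite_dimensional: "finite_dimensional L"
  unfolding finite_dimensional_def
proof (intro exI conjI)
  show "finite (unit_vec ` {1..n})" by simp
  show "V.span (unit_vec ` {1..n}) = carr L"
  proof
    show "V.span (unit_vec ` {1..n}) \<subseteq> carr L"
      by (rule V.span_minimal[OF _ lie_algebraD(3)[OF lie]]) (use unit_vec_carr in auto)
    show "carr L \<subseteq> V.span (unit_vec ` {1..n})"
    proof
      fix x assume "x \<in> carr L"
      from coord_expansion[OF this] show "x \<in> V.span (unit_vec ` {1..n})"
        by (metis (no_types, lifting) V.span_base V.span_scale V.span_sum imageI)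
    qed
  qed
qed

text \<open>
  Coordinate subspaces are invariant under every diagonal map, and some coordinate subspace is
  a complement of \<open>W\<close>: any one that is maximal among those meeting \<open>W\<close> trivially.
\<close>

lemma semisimple_diagonal:
  assumes "\<forall>x\<in>carr L. f x = (\<lambda>i. d i * x i)"
  shows "semisimple_endo L f"
  unfolding semisimple_endo_def
proof (intro allI impI, elim conjE)
  fix W assume W: "W \<subseteq> carr L" "V.subspace W"
  define C where "C S = {x :: nat \<Rightarrow> complex. \<forall>i. i \<notin> S \<longrightarrow> x i = 0}" for S
  have C_carr: "C S \<subseteq> carr L" if "S \<subseteq> {1..n}" for S using that by (auto simp: C_def carr_eq)
  have C_sub: "V.subspace (C S)" for S
    unfolding V.subspace_def by (auto simp: C_def scal_eq)
  define F where "F = {S. S \<subseteq> {1..n} \<and> W \<inter> C S = {0}}"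
  have "finite F" by (rule finite_subset[of _ "Pow {1..n}"]) (auto simp: F_def)
  moreover have "{} \<in> F" using V.subspace_0[OF W(2)] by (auto simp: F_def C_def fun_eq_iff)
  ultimately obtain S where S: "S \<in> F" and max: "\<And>S'. S' \<in> F \<Longrightarrow> S \<subseteq> S' \<Longrightarrow> S = S'"
    using finite_has_maximal[of F] by blast
  define P where "P = {w + u | w u. w \<in> W \<and> u \<in> C S}"
  have P_sub: "V.subspace P" unfolding P_def by (rule V.subspace_sums[OF W(2) C_sub])
  have unit_P: "unit_vec i \<in> P" if i: "i \<in> {1..n}" for i
  proof (cases "i \<in> S")
    case True
    then have "unit_vec i \<in> C S" by (auto simp: C_def unit_vec_def)
    then show ?thesis using V.subspace_0[OF W(2)] by (force simp: P_def)
  next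
    case False
    then have "insert i S \<notin> F" using max[of "insert i S"] by auto
    then obtain w where w: "w \<in> W" "w \<in> C (insert i S)" "w \<noteq> 0"
      using S i V.subspace_0[OF W(2)] V.subspace_0[OF C_sub] by (auto simp: F_def)
    have "w i \<noteq> 0"
    proof
      assume "w i = 0"
      then have "w \<in> C S" using w(2) by (auto simp: C_def)
      then show False using w S by (auto simp: F_def)
    qed
    \<comment> \<open>\<open>w\<close> is supported on \<open>insert i S\<close> and
      \<open>w i\<close> is nonzero, so it solves for \<open>unit_vec i\<close> modulo
      \<open>C S\<close>.\<close>
    define u where "u = unit_vec i - scal L (1 / w i) w"
    have "u \<in> C S" using w(2) \<open>w i \<noteq> 0\<close> by (auto simp: C_def u_def unit_vec_def scal_eq)
    moreover have "unit_vec i = scal L (1 / w i) w + u" by (simp add: u_def)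
    ultimately show ?thesis using V.subspace_scale[OF W(2) w(1)] unfolding P_def by blast
  qed
  have "carr L = P"
  proof
    show "P \<subseteq> carr L"
      using W(1) C_carr S lie_algebraD(5)[OF lie] unfolding P_def F_def by blast
    show "carr L \<subseteq> P"
    proof
      fix x assume "x \<in> carr L"
      from coord_expansion[OF this] show "x \<in> P"
        by (metis (no_types, lifting) V.subspace_sum[OF P_sub] V.subspace_scale[OF P_sub] unit_P)
    qed
  qed
  moreover have "f ` C S \<subseteq> C S"
  proof (rule image_subsetI)
    fix x assume x: "x \<in> C S"
    then have "x \<in> carr L" using C_carr[of S] S by (auto simp: F_def)
    then show "f x \<in> C S" using x assms by (simp add: C_def)
  qed
  ultimately show "\<exists>U\<subseteq>carr L. V.subspace U \<and> f ` U \<subseteq> U \<and> W \<inter> U = {0} \<and> carr L = {w + u |w u. w \<in> W \<and> u \<in> U}"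
    unfolding P_def using C_carr[of S] C_sub[of S] S
    by (intro exI[of _ "C S"]) (simp only: F_def mem_Collect_eq simp_thms)
qed

text \<open>At \<open>unit_vec i\<close> the relation says that (i - j) times the j-th coordinate of
  \<open>f (unit_vec i)\<close> is \<open>d j\<close> for j = i and 0 otherwise. Hence
  \<open>f\<close> is diagonal and \<open>d\<close> vanishes on the index range. The case
  \<open>t = 0\<close> describes the commutant of \<open>weight_op\<close>; a general
  \<open>t\<close> arises from derivations of the semidirect product.\<close>

lemma diagonal_if_commutator_diagonal:
  assumes f: "f \<in> lie_endos L"
    and t: "\<forall>x\<in>carr L. t x = (\<lambda>i. d i * x i)"
    and comm: "\<And>x. x \<in> carr L \<Longrightarrow> f (weight_op x) = t x + weight_op (f x)"
  shows "\<exists>c. \<forall>x\<in>carr L. f x = (\<lambda>i. c i * x i)" "\<And>x. x \<in> carr L \<Longrightarrow> t x = 0"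
proof -
  note E = lie_endosD[OF f]
  have key: "of_nat i * f (unit_vec i) j = d j * unit_vec i j + of_nat j * f (unit_vec i) j"
    if "i \<in> {1..n}" for i j
  proof -
    have u: "unit_vec i \<in> carr L" by (rule unit_vec_carr[OF that])
    have "weight_op (unit_vec i) = scal L (of_nat i) (unit_vec i)"
      by (auto simp: weight_op_def unit_vec_def scal_eq)
    then have "scal L (of_nat i) (f (unit_vec i)) = t (unit_vec i) + weight_op (f (unit_vec i))"
      using comm[OF u] E(4)[OF u] by simp
    from fun_cong[OF this, of j] show ?thesis using t u by (simp add: scal_eq weight_op_def)
  qed
  have off: "f (unit_vec i) j = 0" if "i \<in> {1..n}" "j \<noteq> i" for i j
    using key[OF that(1), of j] that by (simp add: unit_vec_def)
  have d0: "d i = 0" if "i \<in> {1..n}" for i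
    using key[OF that, of i] by (simp add: unit_vec_def)
  show "t x = 0" if "x \<in> carr L" for x
  proof
    fix i
    have "d i * x i = 0" using that d0[of i] by (cases "i \<in> {1..n}") (auto simp: carr_eq)
    then show "t x i = 0 i" using t that by simp
  qed
  have "f x j = f (unit_vec j) j * x j" if x: "x \<in> carr L" for x j
  proof (cases "j \<in> {1..n}")
    case True
    have "f x = f (\<Sum>i\<in>{1..n}. scal L (x i) (unit_vec i))"
      by (rule arg_cong[OF coord_expansion[OF x]])
    also have "\<dots> = (\<Sum>i\<in>{1..n}. f (scal L (x i) (unit_vec i)))"
      using lie_endos_sum[OF lie f, of "{1..n}" "\<lambda>i. scal L (x i) (unit_vec i)"]
        unit_vec_carr lie_algebraD(8)[OF lie] by auto
    also have "\<dots> = (\<Sum>i\<in>{1..n}. scal L (x i) (f (unit_vec i)))"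
      using unit_vec_carr E(4) by (intro sum.cong) auto
    finally have "f x j = (\<Sum>i\<in>{1..n}. x i * f (unit_vec i) j)"
      by (simp add: sum_fun_apply scal_eq)
    also have "\<dots> = (\<Sum>i\<in>{1..n}. if i = j then x i * f (unit_vec i) j else 0)"
      using off by (intro sum.cong) auto
    finally show ?thesis using True by simp
  next
    case False
    then show ?thesis using x E(1)[OF x] by (auto simp: carr_eq)
  qed
  then show "\<exists>c. \<forall>x\<in>carr L. f x = (\<lambda>i. c i * x i)"
    by (intro exI[of _ "\<lambda>j. f (unit_vec j) j"]) (auto simp: fun_eq_iff)
qed

section \<open>The diagonal derivations as a maximal torus\<close>

definition weight_der :: "(nat \<Rightarrow> complex) \<Rightarrow> nat \<Rightarrow> complex" where
  "weight_der x = (if x \<in> carr L then weight_op x else 0)"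

lemma weight_der_simp: "x \<in> carr L \<Longrightarrow> weight_der x = weight_op x"
  by (simp add: weight_der_def)

lemma weight_der_diagonal: "weight_der \<in> diagonal_ders L"
proof -
  have "weight_der \<in> carr (Der L)"
    using lie_algebraD[OF lie] weight_op_carr weight_op_brk
    by (auto simp: Der_def lie_endos_def weight_der_def)
      (auto simp: weight_op_def scal_eq fun_eq_iff algebra_simps)
  then show ?thesis by (auto simp: diagonal_ders_def weight_der_def weight_op_def)
qed

lemma diagonal_ders_commute:
  assumes "f \<in> diagonal_ders L" "g \<in> diagonal_ders L"
  shows "f (g x) = g (f x)"
proof (cases "x \<in> carr L")
  case True
  then have "f x \<in> carr L" "g x \<in> carr L"
    using assms lie_endosD(1)[OF DerD(1)] by (auto simp: diagonal_ders_def)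
  then show ?thesis using assms True by (auto simp: diagonal_ders_def fun_eq_iff)
next
  case False
  have "f \<in> lie_endos L" "g \<in> lie_endos L"
    using assms DerD(1) by (auto simp: diagonal_ders_def)
  then show ?thesis using False by (simp add: lie_endosD(2) lie_endos_0[OF lie])
qed

lemma lie_torus_diagonal_ders: "lie_torus L (diagonal_ders L)"
proof -
  interpret D: vector_space "\<lambda>c f x. scal L c (f x)" by (rule vector_space_pointwise[OF V.vector_space_axioms])
  have br: "(\<lambda>x. f (g x) - g (f x)) = 0" if "f \<in> diagonal_ders L" "g \<in> diagonal_ders L" for f g
    using diagonal_ders_commute[OF that] by (simp add: fun_eq_iff)
  note LD = lie_algebraD[OF lie]
  have zero: "0 \<in> diagonal_ders L"
    using LD lie_brk_0[OF lie]
    by (auto simp: diagonal_ders_def Der_def lie_endos_def fun_eq_iff intro!: exI[of _ "\<lambda>_. 0"])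
  have add: "f + g \<in> diagonal_ders L" if "f \<in> diagonal_ders L" "g \<in> diagonal_ders L" for f g
  proof -
    obtain d e where de: "\<forall>x\<in>carr L. f x = (\<lambda>i. d i * x i)" "\<forall>x\<in>carr L. g x = (\<lambda>i. e i * x i)"
      and m: "f \<in> carr (Der L)" "g \<in> carr (Der L)"
      using \<open>f \<in> _\<close> \<open>g \<in> _\<close> by (auto simp: diagonal_ders_def)
    note E = lie_endosD[OF DerD(1)[OF m(1)]] lie_endosD[OF DerD(1)[OF m(2)]]
    have "f + g \<in> carr (Der L)"
      by (auto simp: Der_def lie_endos_def LD E DerD(2)[OF m(1)] DerD(2)[OF m(2)] V.scale_right_distrib
          add_ac)
    moreover have "\<forall>x\<in>carr L. (f + g) x = (\<lambda>i. (d i + e i) * x i)"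
      using de by (auto simp: fun_eq_iff algebra_simps)
    ultimately show ?thesis
      unfolding diagonal_ders_def by (intro CollectI conjI exI)
  qed
  have scale: "(\<lambda>x. scal L c (f x)) \<in> diagonal_ders L" if "f \<in> diagonal_ders L" for f c
  proof -
    obtain d where d: "\<forall>x\<in>carr L. f x = (\<lambda>i. d i * x i)" and m: "f \<in> carr (Der L)"
      using \<open>f \<in> _\<close> by (auto simp: diagonal_ders_def)
    note E = lie_endosD[OF DerD(1)[OF m]]
    have "(\<lambda>x. scal L c (f x)) \<in> carr (Der L)"
      by (auto simp: Der_def lie_endos_def LD E DerD(2)[OF m] V.scale_right_distrib mult.commute)
    moreover have "\<forall>x\<in>carr L. scal L c (f x) = (\<lambda>i. (c * d i) * x i)"
      using d by (auto simp: fun_eq_iff scal_eq)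
    ultimately show ?thesis
      unfolding diagonal_ders_def by (intro CollectI conjI exI)
  qed
  show ?thesis
    unfolding lie_torus_def lie_subalgebra_def Der_simps
  proof (intro conjI ballI)
    show "diagonal_ders L \<subseteq> carr (Der L)" by (auto simp: diagonal_ders_def)
    show "D.subspace (diagonal_ders L)" using zero add scale by (auto simp: D.subspace_def)
    show "semisimple_endo L f" if "f \<in> diagonal_ders L" for f
      using that semisimple_diagonal by (auto simp: diagonal_ders_def)
  qed (use br zero in auto)
qed

text \<open>A larger torus still contains \<open>weight_der\<close>, so its elements commute with a
  map of simple spectrum and are diagonal.\<close>

lemma maximal_torus_diagonal_ders: "maximal_torus L (diagonal_ders L)"
  unfolding maximal_torus_def
proof (intro conjI allI impI lie_torus_diagonal_ders, elim conjE)
  fix T assume T: "lie_torus L T" "diagonal_ders L \<subseteq> T"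
  have "f \<in> diagonal_ders L" if f: "f \<in> T" for f
  proof -
    have fD: "f \<in> carr (Der L)" using T(1) f by (auto simp: lie_torus_def lie_subalgebra_def)
    have "(\<lambda>x. f (weight_der x) - weight_der (f x)) = 0"
      using T f weight_der_diagonal by (auto simp: lie_torus_def Der_simps)
    then have comm: "f (weight_der x) = weight_der (f x)" for x by (simp add: fun_eq_iff)
    have "\<exists>c. \<forall>x\<in>carr L. f x = (\<lambda>i. c i * x i)"
    proof (rule diagonal_if_commutator_diagonal(1)[OF DerD(1)[OF fD], of "\<lambda>_. 0" "\<lambda>_. 0"])
      show "f (weight_op x) = 0 + weight_op (f x)" if "x \<in> carr L" for x
        using comm[of x] that lie_endosD(1)[OF DerD(1)[OF fD]] by (simp add: weight_der_simp)
    qed auto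
    then show ?thesis using fD by (simp add: diagonal_ders_def)
  qed
  then show "T = diagonal_ders L" using T(2) by blast
qed

section \<open>Completeness of the semidirect product with the diagonal torus\<close>

abbreviation H where "H \<equiv> semidirect (diagonal_ders L) L"

lemma lie_H: "lie_algebra H"
  by (rule lie_algebra_semidirect[OF lie lie_torus_diagonal_ders])

lemma zero_diagonal_ders: "0 \<in> diagonal_ders L"
  using lie_algebraD(4)[OF lie_H] by (simp add: semidirect_simps zero_prod_def)

lemma diagonal_dersD:
  assumes "f \<in> diagonal_ders L"
  shows "f \<in> carr (Der L)" "f \<in> lie_endos L" "f 0 = 0"
    "\<And>x. x \<in> carr L \<Longrightarrow> f x \<in> carr L"
proof -
  show "f \<in> carr (Der L)" using assms by (simp add: diagonal_ders_def)
  then show E: "f \<in> lie_endos L" by (rule DerD(1))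
  show "f 0 = 0" "\<And>x. x \<in> carr L \<Longrightarrow> f x \<in> carr L"
    using lie_endos_0[OF lie E] lie_endosD(1)[OF E] by auto
qed

lemma brk_H:
  assumes "f \<in> diagonal_ders L" "g \<in> diagonal_ders L"
  shows "brk H (f, x) (g, y) = (0, f y - g x + brk L x y)"
proof -
  have "(\<lambda>z. f (g z) - g (f z)) = 0"
    by (rule ext) (simp add: diagonal_ders_commute[OF assms])
  then show ?thesis by (simp add: semidirect_simps)
qed

lemma weight_op_eq_0:
  assumes "x \<in> carr L"
  shows "weight_op x = 0 \<longleftrightarrow> x = 0"
proof
  assume w: "weight_op x = 0"
  show "x = 0"
  proof
    fix i
    have "of_nat i * x i = 0" using fun_cong[OF w, of i] by (simp add: weight_op_def)
    moreover have "x i = 0" if "i = 0" using assms that by (simp add: carr_eq)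
    ultimately show "x i = 0 i" by auto
  qed
qed (auto simp: weight_op_def)

lemma weight_op_surj:
  assumes "x \<in> carr L"
  obtains y where "y \<in> carr L" "weight_op y = x"
proof
  \<comment> \<open>At index 0 there is nothing to invert: \<open>x 0 = 0\<close> on the
    carrier.\<close>
  show "(\<lambda>i. x i / of_nat i) \<in> carr L" "weight_op (\<lambda>i. x i / of_nat i) = x"
    using assms by (auto simp: carr_eq weight_op_def fun_eq_iff)
qed

lemma diagonal_der_eq_0:
  assumes "f \<in> diagonal_ders L" "\<And>x. x \<in> carr L \<Longrightarrow> f x = 0"
  shows "f = 0"
proof
  show "f x = 0 x" for x
    using assms(2) lie_endosD(2)[OF diagonal_dersD(2)[OF assms(1)]] by (cases "x \<in> carr L") auto
qed

text \<open>For a central \<open>(f, x)\<close>, the bracket with \<open>weight_der\<close> gives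
  \<open>weight_op x = 0\<close>, hence \<open>x = 0\<close>; brackets with elements of
  \<open>L\<close> then give \<open>f = 0\<close>.\<close>

lemma center_H: "lie_center H = {0}"
proof -
  note w = weight_der_diagonal and LD = lie_algebraD[OF lie]
  have "(f, x) = 0" if "(f, x) \<in> lie_center H" for f x
  proof -
    have fx: "f \<in> diagonal_ders L" "x \<in> carr L" 
      and c: "\<And>g y. g \<in> diagonal_ders L \<Longrightarrow> y \<in> carr L \<Longrightarrow> brk H (f, x) (g, y) = 0"
      using that by (auto simp: lie_center_def semidirect_simps(1))
    have "weight_op x = 0"
      using c[OF w LD(4)] fx
      by (simp add: brk_H w diagonal_dersD lie_brk_0[OF lie] zero_prod_def weight_der_simp zero_fun_def[symmetric])
    then have "x = 0" using fx weight_op_eq_0 by simp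
    moreover have "f y = 0" if "y \<in> carr L" for y
      using c[OF zero_diagonal_ders that] fx that \<open>x = 0\<close>
      by (simp add: brk_H zero_diagonal_ders lie_brk_0[OF lie] zero_prod_def)
    ultimately show ?thesis using diagonal_der_eq_0[OF fx(1)] by (simp add: zero_prod_def)
  qed
  moreover have "0 \<in> lie_center H"
    using lie_algebraD(4)[OF lie_H] lie_brk_0[OF lie_H] by (auto simp: lie_center_def)
  ultimately show ?thesis by (auto simp: zero_prod_def)
qed

text \<open>The normalized case, in which \<open>D\<close> sends the grading element into the torus.
  Then \<open>D\<close> preserves both the torus and \<open>L\<close>; its restriction
  \<open>s\<close> to \<open>L\<close> is diagonal, and \<open>D\<close> is the bracket with
  \<open>(s, 0)\<close>.\<close>

lemma derivation_H_inner_of_weight_der: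
  assumes D: "D \<in> carr (Der H)" and D0: "D (weight_der, 0) = (t, 0)"
  shows "\<exists>s\<in>diagonal_ders L. \<forall>p\<in>carr H. D p = brk H (s, 0) p"
proof -
  note w = weight_der_diagonal and LD = lie_algebraD[OF lie] and z = zero_diagonal_ders
  note E = lie_endosD[OF DerD(1)[OF D]] and Db = DerD(2)[OF D]
  have D_0: "D (0, 0) = (0, 0)" using lie_endos_0[OF lie_H DerD(1)[OF D]] by (simp add: zero_prod_def)
  have inH: "(f, x) \<in> carr H \<longleftrightarrow> f \<in> diagonal_ders L \<and> x \<in> carr L" for f x
    by (simp add: semidirect_simps)
  have t: "t \<in> diagonal_ders L" using E(1)[of "(weight_der, 0)"] D0 w LD(4) by (simp add: inH)
  \<comment> \<open>Apply \<open>D\<close> to the vanishing bracket of \<open>weight_der\<close> and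
    \<open>f\<close>: what remains is \<open>weight_op v = 0\<close> for the
    \<open>L\<close>-component \<open>v\<close> of \<open>D (f, 0)\<close>.\<close>
  have torus: "\<exists>u\<in>diagonal_ders L. D (f, 0) = (u, 0)" if f: "f \<in> diagonal_ders L" for f
  proof -
    obtain u v where uv: "D (f, 0) = (u, v)" by fastforce
    then have m: "u \<in> diagonal_ders L" "v \<in> carr L" using E(1)[of "(f, 0)"] f LD(4) by (auto simp: inH)
    have "(0, 0) = D (brk H (weight_der, 0) (f, 0))"
      using f w LD(4) D_0 by (simp add: brk_H diagonal_dersD lie_brk_0[OF lie])
    also have "\<dots> = brk H (t, 0) (f, 0) + brk H (weight_der, 0) (u, v)"
      using Db[of "(weight_der, 0)" "(f, 0)"] f w LD(4) D0 uv by (simp add: inH)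
    also have "\<dots> = (0, weight_op v)"
      using f w t m LD(4) by (simp add: brk_H diagonal_dersD lie_brk_0[OF lie] weight_der_simp zero_fun_def[symmetric])
    finally show ?thesis using m uv weight_op_eq_0 by auto
  qed
  \<comment> \<open>Apply \<open>D\<close> to the bracket of \<open>weight_der\<close> and
    \<open>x\<close>, which is \<open>weight_op x\<close>: the image has torus component 0. Every
    element of \<open>L\<close> has the form \<open>weight_op y\<close>, so \<open>D\<close> maps
    \<open>L\<close> into \<open>L\<close>.\<close>
  have comm: "\<exists>v\<in>carr L. D (0, x) = (0, v) \<and> snd (D (0, weight_op x)) = t x + weight_op v"
    if x: "x \<in> carr L" for x
  proof -
    have *: "D (0, weight_op x) = (0, t x + weight_op v)"
      if x: "x \<in> carr L" and uv: "D (0, x) = (u, v)" for x u v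
    proof -
      have m: "u \<in> diagonal_ders L" "v \<in> carr L" using E(1)[of "(0, x)"] x z uv by (auto simp: inH)
      have "D (0, weight_op x) = D (brk H (weight_der, 0) (0, x))"
        using x w z by (simp add: brk_H lie_brk_0[OF lie] weight_der_simp zero_fun_def[symmetric])
      also have "\<dots> = brk H (t, 0) (0, x) + brk H (weight_der, 0) (u, v)"
        using Db[of "(weight_der, 0)" "(0, x)"] x w z LD(4) D0 uv by (simp add: inH)
      also have "\<dots> = (0, t x + weight_op v)"
        using x w t z m LD(4) by (simp add: brk_H diagonal_dersD lie_brk_0[OF lie] weight_der_simp zero_fun_def[symmetric])
      finally show ?thesis .
    qed
    obtain y where y: "y \<in> carr L" "weight_op y = x" using weight_op_surj[OF x] .
    obtain u v where uv: "D (0, x) = (u, v)" by fastforce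
    then have "v \<in> carr L" using E(1)[of "(0, x)"] x z by (auto simp: inH)
    moreover have "u = 0"
      using *[OF y(1)] y(2) uv by (metis Pair_inject surj_pair)
    ultimately show ?thesis using *[OF x] uv by auto
  qed
  define s where "s x = (if x \<in> carr L then snd (D (0, x)) else 0)" for x
  have Ds: "D (0, x) = (0, s x)" "s x \<in> carr L" if "x \<in> carr L" for x
    using comm[OF that] that by (auto simp: s_def)
  have s_add: "s (x + y) = s x + s y" if "x \<in> carr L" "y \<in> carr L" for x y
    using E(3)[of "(0, x)" "(0, y)"] that z by (simp add: inH Ds LD)
  have s_scal: "s (scal L c x) = scal L c (s x)" if "x \<in> carr L" for x c
    using E(4)[of "(0, x)" c] that z by (simp add: inH Ds LD semidirect_simps zero_fun_def[symmetric])
  have s_endo: "s \<in> lie_endos L"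
    using s_add s_scal Ds(2) by (auto simp: lie_endos_def) (simp add: s_def)
  have s_brk: "s (brk L x y) = brk L (s x) y + brk L x (s y)" if "x \<in> carr L" "y \<in> carr L" for x y
    using Db[of "(0, x)" "(0, y)"] that z by (simp add: inH brk_H Ds LD)
  \<comment> \<open>The commutator of \<open>s\<close> and the grading is \<open>t\<close>, which is
    diagonal; this forces \<open>s\<close> to be diagonal.\<close>
  have s_comm: "s (weight_op x) = t x + weight_op (s x)" if "x \<in> carr L" for x
    using comm[OF that] that weight_op_carr[OF that] by (auto simp: s_def)
  obtain d where d: "\<forall>x\<in>carr L. t x = (\<lambda>i. d i * x i)" using t by (auto simp: diagonal_ders_def)
  have sT: "s \<in> diagonal_ders L"
    using diagonal_if_commutator_diagonal(1)[OF s_endo d s_comm] s_endo s_brk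
    by (auto simp: diagonal_ders_def Der_def)
  \<comment> \<open>Applying \<open>D\<close> to the bracket of \<open>f\<close> and
    \<open>x\<close> gives \<open>s (f x) = u x + f (s x)\<close>; as \<open>f\<close> and
    \<open>s\<close> are both diagonal, they commute and \<open>u\<close> vanishes.\<close>
  have D_torus: "D (f, 0) = (0, 0)" if f: "f \<in> diagonal_ders L" for f
  proof -
    obtain u where u: "u \<in> diagonal_ders L" "D (f, 0) = (u, 0)" using torus[OF f] by auto
    have "u x = 0" if x: "x \<in> carr L" for x
    proof -
      have "(0, s (f x)) = D (brk H (f, 0) (0, x))"
        using f x z by (simp add: brk_H lie_brk_0[OF lie] Ds diagonal_dersD)
      also have "\<dots> = brk H (u, 0) (0, x) + brk H (f, 0) (0, s x)"
        using Db[of "(f, 0)" "(0, x)"] f x z u LD(4) by (simp add: inH Ds)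
      also have "\<dots> = (0, u x + f (s x))"
        using f x z u LD(4) Ds(2)[OF x] by (simp add: brk_H diagonal_dersD lie_brk_0[OF lie])
      finally show ?thesis using diagonal_ders_commute[OF f sT] by simp
    qed
    then show ?thesis using u diagonal_der_eq_0 by simp
  qed
  have "D (f, x) = brk H (s, 0) (f, x)" if "f \<in> diagonal_ders L" "x \<in> carr L" for f x
  proof -
    have "D (f, x) = D (f, 0) + D (0, x)"
      using E(3)[of "(f, 0)" "(0, x)"] that z LD(4) by (simp add: inH)
    also have "\<dots> = brk H (s, 0) (f, x)"
      using that sT D_torus by (simp add: brk_H Ds diagonal_dersD lie_brk_0[OF lie] zero_fun_def[symmetric])
    finally show ?thesis .
  qed
  then show ?thesis using sT by (intro bexI[of _ s]) (auto simp: semidirect_simps(1))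
qed

lemma complete_H: "complete_lie H"
  unfolding complete_lie_def
proof (intro conjI lie_H center_H ballI)
  fix D assume D: "D \<in> carr (Der H)"
  note w = weight_der_diagonal and LD = lie_algebraD[OF lie] and z = zero_diagonal_ders
  have wH: "(weight_der, 0) \<in> carr H" using w LD(4) by (simp add: semidirect_simps)
  obtain t x where tx: "D (weight_der, 0) = (t, x)" by fastforce
  then have x: "x \<in> carr L" using lie_endosD(1)[OF DerD(1)[OF D] wH] by (simp add: semidirect_simps)
  obtain y where y: "y \<in> carr L" "weight_op y = x" using weight_op_surj[OF x] .
  \<comment> \<open>The bracket of \<open>a\<close> with \<open>(weight_der, 0)\<close> is
    \<open>(0, weight_op y) = (0, x)\<close>, so subtracting it from \<open>D\<close> removes the
    \<open>L\<close>-component \<open>x\<close>.\<close>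
  define a where "a = (0 :: (nat \<Rightarrow> complex) \<Rightarrow> nat \<Rightarrow> complex, - y)"
  have aH: "a \<in> carr H" using z y LD by (simp add: a_def semidirect_simps)
  have wy: "weight_der (- y) = - x" 
    using y LD(7)[OF y(1)] by (auto simp: weight_der_simp weight_op_def fun_eq_iff)
  define D' where "D' p = (if p \<in> carr H then D p - brk H a p else 0)" for p
  have D': "D' \<in> carr (Der H)"
    using Der_diff_inner[OF lie_H D aH] by (simp add: D'_def[abs_def])
  have "brk H a (weight_der, 0) = (0, x)"
    using w z y LD by (simp add: a_def brk_H lie_brk_0[OF lie] wy)
  then have "D' (weight_der, 0) = (t, 0)" using tx wH by (simp add: D'_def)
  from derivation_H_inner_of_weight_der[OF D' this]
  obtain s where s: "s \<in> diagonal_ders L" "\<And>p. p \<in> carr H \<Longrightarrow> D' p = brk H (s, 0) p" by blast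
  have sH: "(s, 0) \<in> carr H" using s LD(4) by (simp add: semidirect_simps)
  have "D p = brk H ((s, 0) + a) p" if "p \<in> carr H" for p
  proof -
    have "D p = D' p + brk H a p" using that by (simp add: D'_def)
    also have "\<dots> = brk H ((s, 0) + a) p"
      using that s(2)[OF that] lie_algebraD(10)[OF lie_H sH aH that] by simp
    finally show ?thesis .
  qed
  then show "\<exists>b\<in>carr H. \<forall>p\<in>carr H. D p = brk H b p"
    using lie_algebraD(5)[OF lie_H sH aH] by blast
qed

lemma completable_if_nilpotent: "nilpotent_lie L \<Longrightarrow> completable L"
  using lie finite_dimensional maximal_torus_diagonal_ders complete_H by (auto simp: completable_def)

end

section \<open>The algebras \<open>g_alg m k q\<close>\<close>

text \<open>Reduces a decomposition to two summands: \<open>B\<close> is the sum of all the ideals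
  except \<open>I 0\<close>. The two summands commute because a bracket between them lies in
  both.\<close>

lemma direct_sum_of_ideals_split:
  assumes L: "lie_algebra L" and ds: "direct_sum_of_ideals L n I" and n: "n \<ge> 2"
  obtains B where "I 1 \<subseteq> B" "module.subspace (scal L) B" "B \<subseteq> carr L" "I 0 \<inter> B = {0}"
    "\<And>x. x \<in> carr L \<Longrightarrow> \<exists>a\<in>I 0. \<exists>b\<in>B. x = a + b"
    "\<And>x b. x \<in> carr L \<Longrightarrow> b \<in> B \<Longrightarrow> brk L x b \<in> B"
    "\<And>a b. a \<in> I 0 \<Longrightarrow> b \<in> B \<Longrightarrow> brk L a b = 0"
proof
  note LD = lie_algebraD[OF L]
  interpret V: vector_space "scal L" by (rule LD(1))
  have ideal: "lie_ideal L (I i)" if "i < n" for i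
    using ds that by (auto simp: direct_sum_of_ideals_def)
  have Isub: "V.subspace (I i)" and Icarr: "I i \<subseteq> carr L"
    and Ibrk: "\<And>x y. x \<in> carr L \<Longrightarrow> y \<in> I i \<Longrightarrow> brk L x y \<in> I i" if "i < n" for i
    using ideal[OF that] by (auto simp: lie_ideal_def)
  have uniq: "\<exists>!f. f \<in> Pi\<^sub>E {..<n} I \<and> x = (\<Sum>i<n. f i)" if "x \<in> carr L" for x
    using ds that unfolding direct_sum_of_ideals_def by blast
  have sum0: "(\<Sum>i<n. f i) = f 0 + (\<Sum>i\<in>{1..<n}. f i)" for f :: "nat \<Rightarrow> 'a"
  proof -
    have "{..<n} = insert 0 {1..<n}" using n by auto
    then show ?thesis by simp
  qed
  define B where "B = {\<Sum>i\<in>{1..<n}. f i | f. \<forall>i\<in>{1..<n}. f i \<in> I i}"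
  have B_I: "(\<Sum>i\<in>{1..<n}. f i) \<in> B" if "\<And>i. i \<in> {1..<n} \<Longrightarrow> f i \<in> I i" for f
    using that unfolding B_def by blast
  have I_B: "I j \<subseteq> B" if j: "j \<in> {1..<n}" for j
  proof
    fix x assume x: "x \<in> I j"
    have "(\<Sum>i\<in>{1..<n}. if i = j then x else 0) \<in> B"
      by (rule B_I) (use x V.subspace_0[OF Isub] in auto)
    then show "x \<in> B" using j by simp
  qed
  then show "I 1 \<subseteq> B" using n by simp
  show Bsub: "V.subspace B"
    unfolding V.subspace_def
  proof (intro conjI ballI allI)
    show "0 \<in> B" using I_B[of 1] V.subspace_0[OF Isub[of 1]] n by auto
    fix x assume "x \<in> B"
    then obtain f where f: "x = (\<Sum>i\<in>{1..<n}. f i)" "\<And>i. i \<in> {1..<n} \<Longrightarrow> f i \<in> I i"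
      by (auto simp: B_def)
    show "scal L c x \<in> B" for c
      unfolding f(1) V.scale_sum_right by (rule B_I) (use f V.subspace_scale[OF Isub] in auto)
    fix y assume "y \<in> B"
    then obtain g where g: "y = (\<Sum>i\<in>{1..<n}. g i)" "\<And>i. i \<in> {1..<n} \<Longrightarrow> g i \<in> I i"
      by (auto simp: B_def)
    show "x + y \<in> B"
      unfolding f(1) g(1) sum.distrib[symmetric]
      by (rule B_I) (use f g V.subspace_add[OF Isub] in auto)
  qed
  show Bcarr: "B \<subseteq> carr L"
  proof
    fix x assume "x \<in> B"
    then obtain f where f: "x = (\<Sum>i\<in>{1..<n}. f i)" "\<And>i. i \<in> {1..<n} \<Longrightarrow> f i \<in> I i"
      by (auto simp: B_def)
    have "f i \<in> carr L" if "i \<in> {1..<n}" for i using f(2)[OF that] Icarr[of i] that by auto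
    then show "x \<in> carr L" unfolding f(1) by (rule V.subspace_sum[OF LD(3)])
  qed
  show disj: "I 0 \<inter> B = {0}"
  proof
    show "I 0 \<inter> B \<subseteq> {0}"
    proof
      fix x assume x: "x \<in> I 0 \<inter> B"
      then obtain f where f: "x = (\<Sum>i\<in>{1..<n}. f i)" "\<And>i. i \<in> {1..<n} \<Longrightarrow> f i \<in> I i"
        by (auto simp: B_def)
      \<comment> \<open>Two decompositions of \<open>x\<close>, one concentrated in
        \<open>I 0\<close> and one in the remaining ideals; uniqueness identifies them, and index 0
        gives \<open>x = 0\<close>.\<close>
      define u where "u = restrict (\<lambda>i. if i = 0 then x else 0) {..<n}"
      define v where "v = restrict (\<lambda>i. if i = 0 then 0 else f i) {..<n}"
      have uv: "u \<in> Pi\<^sub>E {..<n} I" "v \<in> Pi\<^sub>E {..<n} I"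
        using x f(2) V.subspace_0[OF Isub] by (auto simp: u_def v_def)
      have xu: "x = (\<Sum>i<n. u i)"
      proof -
        have "(\<Sum>i\<in>{1..<n}. u i) = 0" by (rule sum.neutral) (simp add: u_def)
        then show ?thesis unfolding sum0 using n by (simp add: u_def)
      qed
      have xv: "x = (\<Sum>i<n. v i)"
      proof -
        have "(\<Sum>i\<in>{1..<n}. v i) = x" unfolding f(1) by (rule sum.cong) (simp_all add: v_def)
        then show ?thesis unfolding sum0 using n by (simp add: v_def)
      qed
      have "x \<in> carr L" using x Bcarr by auto
      from uniq[OF this] have "u = v"
      proof (rule ex1E)
        fix h assume h: "\<forall>g. g \<in> Pi\<^sub>E {..<n} I \<and> x = (\<Sum>i<n. g i) \<longrightarrow> g = h"
        have "u = h" by (rule h[rule_format, OF conjI[OF uv(1) xu]])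
        also have "h = v" by (rule h[rule_format, OF conjI[OF uv(2) xv], symmetric])
        finally show "u = v" .
      qed
      then have "u 0 = v 0" by simp
      then show "x \<in> {0}" using n by (simp add: u_def v_def)
    qed
    show "{0} \<subseteq> I 0 \<inter> B" using V.subspace_0[OF Isub[of 0]] V.subspace_0[OF Bsub] n by simp
  qed
  show "\<exists>a\<in>I 0. \<exists>b\<in>B. x = a + b" if "x \<in> carr L" for x
  proof -
    obtain f where f: "f \<in> Pi\<^sub>E {..<n} I" "x = (\<Sum>i<n. f i)" using uniq[OF \<open>x \<in> _\<close>] by blast
    have "x = f 0 + (\<Sum>i\<in>{1..<n}. f i)" unfolding f(2) by (rule sum0)
    moreover have "f 0 \<in> I 0" using f(1) n by (auto simp: PiE_iff)
    moreover have "(\<Sum>i\<in>{1..<n}. f i) \<in> B" by (rule B_I) (use f(1) in auto)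
    ultimately show ?thesis by blast
  qed
  show Bbrk: "brk L x b \<in> B" if x: "x \<in> carr L" and "b \<in> B" for x b
  proof -
    obtain f where f: "b = (\<Sum>i\<in>{1..<n}. f i)" "\<And>i. i \<in> {1..<n} \<Longrightarrow> f i \<in> I i"
      using \<open>b \<in> B\<close> by (auto simp: B_def)
    have fc: "f i \<in> carr L" if "i \<in> {1..<n}" for i using f(2)[OF that] Icarr[of i] that by auto
    \<comment> \<open>The cutoff makes this an element of \<open>lie_endos L\<close>, so that it
      distributes over the sum.\<close>
    define ad where "ad y = (if y \<in> carr L then brk L x y else 0)" for y
    have "ad \<in> lie_endos L" using x by (auto simp: lie_endos_def ad_def LD)
    then have "b \<in> carr L \<and> ad b = (\<Sum>i\<in>{1..<n}. ad (f i))"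
      unfolding f(1) using fc by (intro lie_endos_sum[OF L]) auto
    moreover have "(\<Sum>i\<in>{1..<n}. ad (f i)) = (\<Sum>i\<in>{1..<n}. brk L x (f i))"
      by (rule sum.cong) (simp_all only: ad_def fc if_True)
    ultimately have "brk L x b = (\<Sum>i\<in>{1..<n}. brk L x (f i))" by (auto simp: ad_def)
    also have "\<dots> \<in> B" by (rule B_I) (use f(2) x Ibrk in auto)
    finally show ?thesis .
  qed
  show "brk L a b = 0" if ab: "a \<in> I 0" "b \<in> B" for a b
  proof -
    have c: "a \<in> carr L" "b \<in> carr L" using ab Icarr[of 0] Bcarr n by auto
    have "brk L a b \<in> I 0"
      unfolding lie_brk_commute[OF L c] using V.subspace_neg[OF Isub[of 0] Ibrk[of 0]] ab c n by auto
    then show ?thesis using Bbrk[OF c(1) ab(2)] disj by blast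
  qed
qed

section \<open>The bracket in terms of the cut indices and an alternating form\<close>

locale cut_algebra =
  fixes m k :: nat and q :: "nat \<Rightarrow> nat"
  assumes m: "m \<ge> 4" and q_bounds: "\<And>i. i \<in> {1..k} \<Longrightarrow> 3 \<le> q i \<and> q i \<le> m + 1"
begin

text \<open>The indices at which the coordinate of the bracket is cut to 0; \<open>q\<close> enters
  the bracket only through this set.\<close>

definition Q :: "nat set" where
  "Q = q ` {1..k} \<union> (\<lambda>i. 2 * m + 2 - q i) ` {1..k}"

text \<open>The form d omega_(2m+1), written over the full index range: a signed pairing of the
  coordinates j and 2m + 1 - j, from which nondegeneracy can be read off.\<close>

definition \<omega> :: "(nat \<Rightarrow> complex) \<Rightarrow> (nat \<Rightarrow> complex) \<Rightarrow> complex" where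
  "\<omega> x y = (\<Sum>j\<in>{2..2*m-1}. (-1) ^ j * x j * y (2 * m + 1 - j))"

abbreviation G where "G \<equiv> g_alg m k q"

text \<open>The coordinates 2m and 2m + 1 of the bracket are thus never cut.\<close>

lemma Q_bounds: "l \<in> Q \<Longrightarrow> 3 \<le> l \<and> l \<le> 2 * m - 1"
  using q_bounds m by (fastforce simp: Q_def)

lemma Q_reflect:
  assumes "l \<le> 2 * m + 2"
  shows "2 * m + 2 - l \<in> Q \<longleftrightarrow> l \<in> Q"
proof -
  have *: "2 * m + 2 - l \<in> Q" if "l \<in> Q" for l
  proof -
    obtain i where i: "i \<in> {1..k}" "l = q i \<or> l = 2 * m + 2 - q i" using \<open>l \<in> Q\<close> unfolding Q_def by blast
    moreover have "2 * m + 2 - (2 * m + 2 - q i) = q i" using q_bounds[OF i(1)] by simp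
    ultimately show ?thesis by (auto simp: Q_def)
  qed
  show ?thesis using *[of l] *[of "2 * m + 2 - l"] assms by auto
qed

text \<open>Reflecting j to 2m + 1 - j in the upper half of the sum reverses the sign, as 2m + 1 is
  odd, and produces the negative terms of the wedges.\<close>

lemma omega_half: "\<omega> x y = (\<Sum>j=2..m. (-1) ^ j * wedge j (2 * m + 1 - j) x y)"
proof -
  have "{2..2*m-1} = {2..m} \<union> {m+1..2*m-1}" using m by auto
  then have "\<omega> x y = (\<Sum>j\<in>{2..m}. (-1) ^ j * x j * y (2 * m + 1 - j))
      + (\<Sum>j\<in>{m+1..2*m-1}. (-1) ^ j * x j * y (2 * m + 1 - j))"
    unfolding \<omega>_def by (simp add: sum.union_disjoint)
  also have "(\<Sum>j\<in>{m+1..2*m-1}. (-1) ^ j * x j * y (2 * m + 1 - j))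
      = (\<Sum>j\<in>{2..m}. - ((-1) ^ j * x (2 * m + 1 - j) * y j))"
  proof (rule sum.reindex_bij_witness[of _ "\<lambda>j. 2 * m + 1 - j" "\<lambda>j. 2 * m + 1 - j"])
    fix j assume j: "j \<in> {m+1..2*m-1}"
    show "- ((-1) ^ (2 * m + 1 - j) * x (2 * m + 1 - (2 * m + 1 - j)) * y (2 * m + 1 - j)) =
        (-1) ^ j * x j * y (2 * m + 1 - j)"
    proof -
      have "(-1 :: complex) ^ (2 * m + 1 - j) * (-1) ^ j = -1"
        unfolding power_add[symmetric] using j by (auto simp: minus_one_power_iff)
      then have "(-1 :: complex) ^ (2 * m + 1 - j) = - ((-1) ^ j)"
        by (cases "even j") auto
      moreover have "2 * m + 1 - (2 * m + 1 - j) = j" using j by auto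
      ultimately show ?thesis by simp
    qed
  qed auto
  finally show ?thesis by (simp add: wedge_def sum.distrib[symmetric] algebra_simps)
qed

lemma G_simps:
  "carr G = {x. \<forall>i. i \<notin> {1..2 * m + 1} \<longrightarrow> x i = 0}" "scal G = (\<lambda>c x i. c * x i)"
  by (simp_all add: g_alg_def)

lemma G_brk:
  "brk G x y l = (if 3 \<le> l \<and> l \<le> 2 * m \<and> l \<notin> Q then x 1 * y (l - 1) - x (l - 1) * y 1
     else if l = 2 * m + 1 then \<omega> x y else 0)"
proof -
  have "brk G x y l = d_omega m k q l x y" by (simp add: g_alg_def)
  also have "\<dots> = (if l \<in> Q then 0
      else if 3 \<le> l \<and> l \<le> 2 * m then wedge 1 (l - 1) x y
      else if l = 2 * m + 1 then \<omega> x y else 0)"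
    unfolding d_omega_def Q_def[symmetric] omega_half ..
  finally show ?thesis using Q_bounds[of "2 * m + 1"] by (auto simp: wedge_def)
qed

section \<open>The Jacobi identity\<close>

lemma omega_linear:
  "\<omega> (x + y) z = \<omega> x z + \<omega> y z" "\<omega> x (y + z) = \<omega> x y + \<omega> x z"
  "\<omega> (\<lambda>i. c * x i) y = c * \<omega> x y" "\<omega> x (\<lambda>i. c * y i) = c * \<omega> x y"
  by (simp_all add: \<omega>_def sum.distrib sum_distrib_left algebra_simps)

lemma omega_self: "\<omega> x x = 0"
  unfolding omega_half by (simp add: wedge_def)

text \<open>
  The form \<open>\<omega>(x, [X\<^sub>1, z])\<close> is symmetric because \<open>Q\<close> is invariant under
  \<open>l \<mapsto> 2m + 2 - l\<close>.
\<close>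

definition \<sigma> :: "(nat \<Rightarrow> complex) \<Rightarrow> (nat \<Rightarrow> complex) \<Rightarrow> complex" where
  "\<sigma> x z = (\<Sum>j\<in>{2..2*m-2}. if j + 1 \<in> Q then 0 else (-1) ^ j * x j * z (2 * m - j))"

text \<open>Substitute 2m - j for j: the parity stays, and j + 1 moves to its mirror image 2m + 2 -
  (j + 1).\<close>

lemma sigma_commute: "\<sigma> x z = \<sigma> z x"
  unfolding \<sigma>_def
proof (rule sum.reindex_bij_witness[of _ "\<lambda>j. 2 * m - j" "\<lambda>j. 2 * m - j"])
  fix j assume j: "j \<in> {2..2*m-2}"
  have "j \<le> 2 * m - 2" using j by simp
  then have "2 * m - j + 1 = 2 * m + 2 - (j + 1)" by linarith
  then have "2 * m - j + 1 \<in> Q \<longleftrightarrow> j + 1 \<in> Q" using Q_reflect[of "j + 1"] j by simp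
  moreover have "(-1 :: complex) ^ (2 * m - j) = (-1) ^ j"
    using j by (auto simp: minus_one_power_iff)
  ultimately show "(if 2 * m - j + 1 \<in> Q then 0 else (-1) ^ (2 * m - j) * z (2 * m - j) * x (2 * m - (2 * m - j))) =
    (if j + 1 \<in> Q then 0 else (-1) ^ j * x j * z (2 * m - j))"
    using \<open>j \<le> 2 * m - 2\<close> by simp
qed auto

text \<open>Up to index 2m the bracket of y and z has the coordinates of y_1 [X_1, z] - z_1
  [X_1, y], and \<open>\<omega>\<close> sees no index beyond 2m - 1.\<close>

lemma omega_brk: "\<omega> x (brk G y z) = y 1 * \<sigma> x z - z 1 * \<sigma> x y"
proof -
  have s: "{2..2*m-1} = insert (2*m-1) {2..2*m-2}" using m by auto
  have "\<omega> x (brk G y z) = (\<Sum>j\<in>{2..2*m-2}. (-1) ^ j * x j * brk G y z (2 * m + 1 - j))"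
  proof -
    \<comment> \<open>The term j = 2m - 1 drops out: it pairs with coordinate 2, which is 0 in every
      bracket.\<close>
    have "2 * m + 1 - (2 * m - 1) = 2" "2 * m - 1 \<notin> {2..2*m-2}" using m by auto
    then show ?thesis unfolding \<omega>_def s by (simp add: G_brk[of y z 2])
  qed
  also have "\<dots> = (\<Sum>j\<in>{2..2*m-2}. y 1 * (if j + 1 \<in> Q then 0 else (-1) ^ j * x j * z (2 * m - j))
     - z 1 * (if j + 1 \<in> Q then 0 else (-1) ^ j * x j * y (2 * m - j)))"
  proof (rule sum.cong[OF refl])
    fix j assume j: "j \<in> {2..2*m-2}"
    have "2 * m + 1 - j = 2 * m + 2 - (j + 1)" by simp
    moreover have "j + 1 \<le> 2 * m + 2" using j by auto
    ultimately have "2 * m + 1 - j \<in> Q \<longleftrightarrow> j + 1 \<in> Q" using Q_reflect[of "j + 1"] by simp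
    moreover have "2 * m + 1 - j - 1 = 2 * m - j" by simp
    moreover have "3 \<le> 2 * m + 1 - j" "2 * m + 1 - j \<le> 2 * m" "2 * m + 1 - j \<noteq> 2 * m + 1"
      using j by auto
    ultimately show "(-1) ^ j * x j * brk G y z (2 * m + 1 - j) =
      y 1 * (if j + 1 \<in> Q then 0 else (-1) ^ j * x j * z (2 * m - j))
      - z 1 * (if j + 1 \<in> Q then 0 else (-1) ^ j * x j * y (2 * m - j))"
      by (simp add: G_brk algebra_simps)
  qed
  also have "\<dots> = y 1 * \<sigma> x z - z 1 * \<sigma> x y"
    by (simp add: \<sigma>_def sum_subtractf sum_distrib_left)
  finally show ?thesis .
qed

lemma vector_space_G: "vector_space (scal G)"
  unfolding G_simps by unfold_locales (auto simp: fun_eq_iff algebra_simps)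

lemma subspace_G:
  "module.subspace (scal G) S \<longleftrightarrow> 0 \<in> S \<and> (\<forall>x\<in>S. \<forall>y\<in>S. x + y \<in> S) \<and> (\<forall>c. \<forall>x\<in>S. (\<lambda>i. c * x i) \<in> S)"
proof -
  interpret V: vector_space "scal G" by (rule vector_space_G)
  show ?thesis unfolding V.subspace_def unfolding G_simps by blast
qed

text \<open>In the last coordinate the cyclic sum cancels by the symmetry of
  \<open>\<sigma>\<close>. In the others, brackets have first coordinate 0, so a double bracket is
  \<open>x 1\<close> times a shifted simple one, and the cyclic sum cancels term by term.\<close>

lemma G_jacobi: "brk G x (brk G y z) + brk G y (brk G z x) + brk G z (brk G x y) = 0"
proof
  fix l
  have one: "brk G x y 1 = 0" for x y using m by (simp add: G_brk)
  show "(brk G x (brk G y z) + brk G y (brk G z x) + brk G z (brk G x y)) l = 0 l"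
  proof (cases "l = 2 * m + 1")
    case True
    then have "brk G x (brk G y z) l = \<omega> x (brk G y z)" for x y z by (simp add: G_brk)
    then show ?thesis
      by (simp add: omega_brk sigma_commute[of y x] sigma_commute[of z x] sigma_commute[of z y])
  next
    case False
    then have "brk G x (brk G y z) l =
        (if 3 \<le> l \<and> l \<le> 2 * m \<and> l \<notin> Q then x 1 * brk G y z (l - 1) else 0)" for x y z
      using one[of y z] by (auto simp: G_brk[of x "brk G y z"])
    moreover have "x 1 * brk G y z (l - 1) + y 1 * brk G z x (l - 1) + z 1 * brk G x y (l - 1) = 0"
      if "l \<le> 2 * m"
    proof -
      have "l - 1 \<noteq> 2 * m + 1" using that by simp
      then show ?thesis unfolding G_brk by (simp add: algebra_simps)
    qed
    ultimately show ?thesis by simp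
  qed
qed

section \<open>Grading and nilpotency\<close>

lemma lie_G: "lie_algebra G"
  unfolding lie_algebra_def
proof (intro conjI ballI allI)
  show "vector_space (scal G)" by (rule vector_space_G)
  show "module.subspace (scal G) (carr G)" unfolding subspace_G by (auto simp: G_simps)
  show "brk G x (brk G y z) + brk G y (brk G z x) + brk G z (brk G x y) = 0" for x y z by (rule G_jacobi)
  show "brk G x y \<in> carr G" for x y using m by (auto simp: G_simps G_brk)
qed (auto simp: fun_eq_iff G_brk G_simps omega_linear omega_self algebra_simps)

text \<open>The weights add up: coordinate l comes from the indices 1 and l - 1, and coordinate 2m +
  1 from j and 2m + 1 - j.\<close>

sublocale weighted_lie "2 * m + 1" G
proof
  fix x y
  have om: "of_nat (2 * m + 1) * \<omega> x y = \<omega> (weight_op x) y + \<omega> x (weight_op y)"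
    unfolding \<omega>_def sum_distrib_left sum.distrib[symmetric]
  proof (rule sum.cong[OF refl])
    fix j assume "j \<in> {2..2 * m - 1}"
    then have "2 * m + 1 = j + (2 * m + 1 - j)" by auto
    then have "(of_nat (2 * m + 1) :: complex) = of_nat j + of_nat (2 * m + 1 - j)"
      by (metis of_nat_add)
    then show "of_nat (2 * m + 1) * ((-1) ^ j * x j * y (2 * m + 1 - j)) =
      (-1) ^ j * weight_op x j * y (2 * m + 1 - j) + (-1) ^ j * x j * weight_op y (2 * m + 1 - j)"
      by (simp only: weight_op_def) (simp add: algebra_simps)
  qed
  show "weight_op (brk G x y) = brk G (weight_op x) y + brk G x (weight_op y)"
  proof
    fix l
    consider "l = 2 * m + 1" | "3 \<le> l" "l \<le> 2 * m" "l \<notin> Q" |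
      "l \<noteq> 2 * m + 1" "\<not> (3 \<le> l \<and> l \<le> 2 * m \<and> l \<notin> Q)" by blast
    then show "weight_op (brk G x y) l = (brk G (weight_op x) y + brk G x (weight_op y)) l"
    proof cases
      case 1
      then show ?thesis using om by (simp add: G_brk weight_op_def[of "brk G x y"])
    next
      case 2
      then have "(of_nat l :: complex) = of_nat (l - 1) + 1" by simp
      then show ?thesis using 2 by (simp add: G_brk weight_op_def algebra_simps)
    next
      case 3
      then show ?thesis by (auto simp: G_brk weight_op_def)
    qed
  qed
qed (use lie_G in \<open>simp_all add: G_simps\<close>)

lemma nilpotent_G: "nilpotent_lie G"
proof -
  \<comment> \<open>The filtration by weight; bracketing raises the weight by at least 1.\<close>
  define F where "F n = {x \<in> carr G. \<forall>i\<le>n. x i = 0}" for n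
  have F_sub: "V.subspace (F n)" for n
    unfolding subspace_G by (auto simp: F_def G_simps)
  have "lower_central G n \<subseteq> F n" for n
  proof (induction n)
    case 0
    then show ?case by (auto simp: F_def G_simps)
  next
    case (Suc n)
    have "brk G x y \<in> F (Suc n)" if x: "x \<in> carr G" and y: "y \<in> F n" for x y
    proof -
      have "brk G x y l = 0" if l: "l \<le> Suc n" for l
      proof -
        \<comment> \<open>The coordinate 2m + 1 matters only once 2m + 1 \<le> n + 1, and then
          \<open>y\<close> vanishes on the whole range of \<open>\<omega>\<close>.\<close>
        have "\<omega> x y = 0" if "2 * m \<le> n" 
          unfolding \<omega>_def using y that by (intro sum.neutral) (auto simp: F_def)
        moreover have "y (l - 1) = 0" "3 \<le> l \<Longrightarrow> y 1 = 0" using y l by (auto simp: F_def)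
        ultimately show ?thesis using l by (auto simp: G_brk)
      qed
      then show ?thesis using x y lie_algebraD(9)[OF lie_G] by (auto simp: F_def)
    qed
    then show ?case using Suc by (auto intro!: V.span_minimal[OF _ F_sub])
  qed
  moreover have "F (2 * m + 1) \<subseteq> {0}"
  proof (clarify, rule ext)
    fix x i assume "x \<in> F (2 * m + 1)"
    then show "x i = 0 i" by (cases "i \<le> 2 * m + 1") (auto simp: F_def G_simps)
  qed
  ultimately have "lower_central G (2 * m + 1) \<subseteq> {0}" by blast
  moreover have "0 \<in> lower_central G (2 * m + 1)" using V.span_zero by simp
  ultimately show ?thesis unfolding nilpotent_lie_def by blast
qed

lemma completable_G: "completable G"
  by (rule completable_if_nilpotent[OF nilpotent_G])

section \<open>Indecomposability\<close>

lemma omega_unit_vec: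
  assumes "j \<in> {2..2*m-1}"
  shows "\<omega> x (unit_vec (2 * m + 1 - j)) = (-1) ^ j * x j"
proof -
  have "\<omega> x (unit_vec (2 * m + 1 - j)) = (\<Sum>i\<in>{2..2*m-1}. if i = j then (-1) ^ i * x i else 0)"
    unfolding \<omega>_def using assms by (intro sum.cong) (auto simp: unit_vec_def)
  then show ?thesis using assms by simp
qed

text \<open>Testing against vectors with first coordinate 0 suffices, since the partner index 2m + 1
  - j is at least 2. Orthogonality is later available only on that hyperplane.\<close>

lemma nondegenerate:
  assumes "\<And>y. y \<in> carr G \<Longrightarrow> y 1 = 0 \<Longrightarrow> \<omega> x y = 0" "j \<in> {2..2*m-1}"
  shows "x j = 0"
proof -
  have "unit_vec (2 * m + 1 - j) \<in> carr G" "unit_vec (2 * m + 1 - j) 1 = 0"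
    using assms(2) by (auto simp: G_simps unit_vec_def)
  then have "\<omega> x (unit_vec (2 * m + 1 - j)) = 0" by (rule assms(1))
  then show ?thesis using omega_unit_vec[OF assms(2)] by simp
qed

text \<open>
  The coordinate of the bracket along \<open>X\<^sub>2\<^sub>m\<close> is a form of rank 2 in the coordinates
  1 and \<open>2m - 1\<close>; if it does not vanish on \<open>A\<close>, then these coordinates vanish on
  everything that commutes with \<open>A\<close>.
\<close>

lemma indecomposable_aux:
  assumes A: "V.subspace A" "A \<subseteq> carr G" and B: "V.subspace B" "B \<subseteq> carr G"
    and disj: "A \<inter> B = {0}"
    and sum: "\<And>x. x \<in> carr G \<Longrightarrow> \<exists>a\<in>A. \<exists>b\<in>B. x = a + b"
    and comm: "\<And>a b. a \<in> A \<Longrightarrow> b \<in> B \<Longrightarrow> brk G a b = 0"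
    and ideal: "\<And>a b. a \<in> A \<Longrightarrow> b \<in> A \<Longrightarrow> brk G a b \<in> A" "\<And>a b. a \<in> B \<Longrightarrow> b \<in> B \<Longrightarrow> brk G a b \<in> B"
    and a: "a \<in> A" "a' \<in> A" "brk G a a' (2 * m) \<noteq> 0"
  shows "B = {0}"
proof -
  let ?p = "2 * m - 1"
  have top: "brk G x y (2 * m) = x 1 * y ?p - x ?p * y 1" for x y
    using m Q_bounds[of "2 * m"] by (auto simp: G_brk)
  have last: "brk G x y (2 * m + 1) = \<omega> x y" for x y by (simp add: G_brk)
  have det: "a 1 * a' ?p - a ?p * a' 1 \<noteq> 0" using a(3) by (simp add: top)
  have B1: "b 1 = 0" if "b \<in> B" for b
  proof -
    have "a 1 * b ?p - a ?p * b 1 = 0" "a' 1 * b ?p - a' ?p * b 1 = 0"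
      using comm[OF a(1) that] comm[OF a(2) that] top[of a b] top[of a' b] by auto
    \<comment> \<open>Eliminate \<open>b ?p\<close> from the two equations, as in Cramer's
      rule.\<close>
    then have "b 1 * (a 1 * a' ?p - a ?p * a' 1) = 0" by algebra
    then show ?thesis using det by simp
  qed
  have perp: "\<omega> a b = 0" if "a \<in> A" "b \<in> B" for a b
    using comm[OF that] last[of a b] by simp
  \<comment> \<open>On the hyperplane of first coordinate 0 the bracket is of Heisenberg
    type.\<close>
  have brk0: "brk G x y = scal G (\<omega> x y) (unit_vec (2 * m + 1))" if "x 1 = 0" "y 1 = 0" for x y
    using that by (auto simp: fun_eq_iff G_brk G_simps unit_vec_def)
  \<comment> \<open>Otherwise X_(2m+1) lies in \<open>B\<close>, which makes the part of
    \<open>A\<close> in the hyperplane isotropic, hence orthogonal to the whole hyperplane.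
    Nondegeneracy then contradicts \<open>det\<close>.\<close>
  have B_isotropic: "\<omega> b b' = 0" if b: "b \<in> B" "b' \<in> B" for b b'
  proof (rule ccontr)
    assume ne: "\<omega> b b' \<noteq> 0"
    have "scal G (1 / \<omega> b b') (brk G b b') \<in> B" using ideal(2)[OF b] V.subspace_scale[OF B(1)] by blast
    then have uB: "unit_vec (2 * m + 1) \<in> B" using brk0[of b b'] B1 b ne by simp
    have A_isotropic: "\<omega> x y = 0" if "x \<in> A" "y \<in> A" "x 1 = 0" "y 1 = 0" for x y
    proof -
      have "brk G x y \<in> B"
        unfolding brk0[of x y, OF that(3,4)] by (rule V.subspace_scale[OF B(1) uB])
      then have "brk G x y \<in> A \<inter> B" using ideal(1)[OF that(1,2)] by blast
      then show ?thesis using disj last[of x y] by simp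
    qed
    have A0: "x ?p = 0" if x: "x \<in> A" "x 1 = 0" for x
    proof (rule nondegenerate)
      show "\<omega> x y = 0" if "y \<in> carr G" "y 1 = 0" for y
      proof -
        obtain c d where cd: "c \<in> A" "d \<in> B" "y = c + d" using sum[OF \<open>y \<in> carr G\<close>] by blast
        then have "c 1 = 0" using B1[OF cd(2)] that by simp
        then show ?thesis using cd x by (simp add: omega_linear A_isotropic perp)
      qed
    qed (use m in auto)
    \<comment> \<open>The combination of \<open>a\<close> and \<open>a'\<close> with first
      coordinate 0; its coordinate \<open>?p\<close> is the determinant.\<close>
    define v where "v = scal G (a 1) a' - scal G (a' 1) a"
    have "v \<in> A" using a V.subspace_diff[OF A(1)] V.subspace_scale[OF A(1)] by (simp add: v_def)
    moreover have "v 1 = 0" by (simp add: v_def G_simps)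
    ultimately have "v ?p = 0" by (rule A0)
    then show False using det by (simp add: v_def G_simps mult.commute)
  qed
  \<comment> \<open>\<open>B\<close> is now orthogonal to both \<open>A\<close> and
    \<open>B\<close>, hence to everything.\<close>
  have B_mid: "b j = 0" if b: "b \<in> B" and j: "j \<in> {2..2*m-1}" for b j
  proof (rule nondegenerate[OF _ j])
    show "\<omega> b y = 0" if y: "y \<in> carr G" "y 1 = 0" for y
    proof -
      obtain c d where cd: "c \<in> A" "d \<in> B" "y = c + d" using sum[OF y(1)] by blast
      have "brk G b c = 0"
        using lie_brk_commute[OF lie_G, of b c] comm[OF cd(1) b] b cd A B by auto
      then have "\<omega> b c = 0" using last[of b c] by simp
      then show ?thesis using cd b by (simp add: omega_linear B_isotropic)
    qed
  qed
  \<comment> \<open>\<open>B\<close> is abelian and commutes with \<open>A\<close>, so only the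
    \<open>A\<close>-components contribute to a bracket.\<close>
  have brk_A: "brk G x y \<in> A" if xy: "x \<in> carr G" "y \<in> carr G" for x y
  proof -
    obtain c d where cd: "c \<in> A" "d \<in> B" "x = c + d" using sum[OF xy(1)] by blast
    obtain c' d' where cd': "c' \<in> A" "d' \<in> B" "y = c' + d'" using sum[OF xy(2)] by blast
    have c: "c \<in> carr G" "d \<in> carr G" "c' \<in> carr G" "d' \<in> carr G" using cd cd' A B by auto
    have "brk G d d' = 0" using brk0[of d d'] B1 B_isotropic cd cd' by simp
    moreover have "brk G d c' = 0" using lie_brk_commute[OF lie_G c(2,3)] comm cd cd' by simp
    ultimately have "brk G x y = brk G c c'"
      using c cd cd' by (simp add: comm lie_algebraD[OF lie_G])
    then show ?thesis using ideal(1) cd cd' by simp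
  qed
  have "b = 0" if b: "b \<in> B" for b
  proof -
    \<comment> \<open>Only the coordinates 2m and 2m + 1 of \<open>b\<close> are left. They are
      supplied by [X_1, X_(2m-1)] = X_2m and [X_2, X_(2m-1)] = X_(2m+1), which places
      \<open>b\<close> in \<open>A\<close>.\<close>
    define u where "u = scal G (b (2 * m)) (unit_vec ?p)"
    define v where "v = scal G (b (2 * m + 1)) (unit_vec ?p)"
    have uv: "u \<in> carr G" "v \<in> carr G"
      unfolding u_def v_def using m by (auto intro!: lie_algebraD(8)[OF lie_G] unit_vec_carr)
    have e: "unit_vec 1 \<in> carr G" "unit_vec 2 \<in> carr G" using m by (auto intro!: unit_vec_carr)
    have p: "?p = 2 * m + 1 - 2" by simp
    have om: "\<omega> (unit_vec i) (scal G c (unit_vec ?p)) = c * unit_vec i 2" for i c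
      unfolding p G_simps using omega_unit_vec[of 2] m by (simp add: omega_linear)
    have "b = brk G (unit_vec 1) u + brk G (unit_vec 2) v"
    proof
      fix l
      have bl: "b l = 0" if "l \<noteq> 2 * m" "l \<noteq> 2 * m + 1"
      proof -
        have "l = 1 \<or> l \<in> {2..2*m-1} \<or> l \<notin> {1..2*m+1}" using that by auto
        then consider "l = 1" | "l \<in> {2..2*m-1}" | "l \<notin> {1..2*m+1}" by blast
        then show ?thesis using b B1 B_mid B(2) by cases (auto simp: G_simps)
      qed
      consider "l = 2 * m" | "l = 2 * m + 1" | "l \<noteq> 2 * m" "l \<noteq> 2 * m + 1" by blast
      then show "b l = (brk G (unit_vec 1) u + brk G (unit_vec 2) v) l"
      proof cases
        case 1
        then show ?thesis using m by (simp add: top u_def v_def) (auto simp: unit_vec_def G_simps)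
      next
        case 2
        show ?thesis unfolding 2 plus_fun_apply last u_def v_def om by (simp add: unit_vec_def)
      next
        case 3
        then have "l - 1 \<noteq> ?p" using m by linarith
        then show ?thesis using 3 m bl
          by (simp add: G_brk) (auto simp: u_def v_def unit_vec_def G_simps)
      qed
    qed
    then have "b \<in> A" using brk_A[OF e(1) uv(1)] brk_A[OF e(2) uv(2)] V.subspace_add[OF A(1)] by metis
    then show ?thesis using b disj by blast
  qed
  then show ?thesis using V.subspace_0[OF B(1)] by blast
qed

text \<open>The bracket of X_1 and X_(2m-1) has coordinate 1 along X_2m and is the sum of a bracket
  in \<open>A\<close> and one in \<open>B\<close>. One of these has nonzero coordinate there, and
  the situation is symmetric in \<open>A\<close> and \<open>B\<close>.\<close>

lemma indecomposable:
  assumes A: "V.subspace A" "A \<subseteq> carr G" and B: "V.subspace B" "B \<subseteq> carr G"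
    and disj: "A \<inter> B = {0}"
    and sum: "\<And>x. x \<in> carr G \<Longrightarrow> \<exists>a\<in>A. \<exists>b\<in>B. x = a + b"
    and comm: "\<And>a b. a \<in> A \<Longrightarrow> b \<in> B \<Longrightarrow> brk G a b = 0"
    and ideal: "\<And>a b. a \<in> A \<Longrightarrow> b \<in> A \<Longrightarrow> brk G a b \<in> A" "\<And>a b. a \<in> B \<Longrightarrow> b \<in> B \<Longrightarrow> brk G a b \<in> B"
  shows "A = {0} \<or> B = {0}"
proof -
  have comm': "brk G b a = 0" if "b \<in> B" "a \<in> A" for a b
    using comm[OF that(2,1)] lie_brk_commute[OF lie_G, of b a] A B that by auto
  have e: "unit_vec 1 \<in> carr G" "unit_vec (2 * m - 1) \<in> carr G" using m by (auto intro!: unit_vec_carr)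
  obtain a b where ab: "a \<in> A" "b \<in> B" "unit_vec 1 = a + b" using sum[OF e(1)] by blast
  obtain a' b' where ab': "a' \<in> A" "b' \<in> B" "unit_vec (2 * m - 1) = a' + b'" using sum[OF e(2)] by blast
  have c: "a \<in> carr G" "b \<in> carr G" "a' \<in> carr G" "b' \<in> carr G" using ab ab' A B by auto
  have "brk G (unit_vec 1) (unit_vec (2 * m - 1)) = brk G a a' + brk G b b'"
    unfolding ab(3) ab'(3) using c ab ab' by (simp add: lie_algebraD[OF lie_G] comm comm')
  moreover have "brk G (unit_vec 1) (unit_vec (2 * m - 1)) (2 * m) = 1"
    using m Q_bounds[of "2 * m"] by (auto simp: G_brk unit_vec_def)
  ultimately have "brk G a a' (2 * m) \<noteq> 0 \<or> brk G b b' (2 * m) \<noteq> 0" by auto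
  then show ?thesis
  proof
    assume "brk G a a' (2 * m) \<noteq> 0"
    from indecomposable_aux[OF A B disj sum comm ideal ab(1) ab'(1) this] show ?thesis by simp
  next
    assume *: "brk G b b' (2 * m) \<noteq> 0"
    have disj': "B \<inter> A = {0}" using disj by blast
    have sum': "\<exists>b\<in>B. \<exists>a\<in>A. x = b + a" if "x \<in> carr G" for x
      using sum[OF that] by (metis add.commute)
    from indecomposable_aux[OF B A disj' sum' comm' ideal(2,1) ab(2) ab'(2) *] show ?thesis by simp
  qed
qed

end

theorem mainTheorem5:
  fixes m k :: nat and q :: "nat \<Rightarrow> nat"
  assumes "m \<ge> 4" and "k \<ge> 1"
    and "strict_mono_on {1..k} q"
    and "\<And>i. i \<in> {1..k} \<Longrightarrow> 3 \<le> q i \<and> q i \<le> m + 1"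
  shows "simple_completable (g_alg m k q)"
proof -
  interpret cut_algebra m k q by (rule cut_algebra.intro[OF assms(1,4)])
  have False if n: "n \<ge> 2" and ds: "direct_sum_of_ideals G n I" and ne: "\<forall>i<n. I i \<noteq> {0}" for n I
  proof -
    \<comment> \<open>\<open>I 0\<close> and the sum \<open>B\<close> of the other ideals form a
      decomposition into two; \<open>I 1 \<subseteq> B\<close> keeps \<open>B\<close>
      nonzero.\<close>
    obtain B where B: "I 1 \<subseteq> B" "V.subspace B" "B \<subseteq> carr G" "I 0 \<inter> B = {0}"
      "\<And>x. x \<in> carr G \<Longrightarrow> \<exists>a\<in>I 0. \<exists>b\<in>B. x = a + b"
      "\<And>x b. x \<in> carr G \<Longrightarrow> b \<in> B \<Longrightarrow> brk G x b \<in> B"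
      "\<And>a b. a \<in> I 0 \<Longrightarrow> b \<in> B \<Longrightarrow> brk G a b = 0"
      by (rule direct_sum_of_ideals_split[OF lie_G ds n]) blast
    have A: "V.subspace (I 0)" "I 0 \<subseteq> carr G" "\<And>x b. x \<in> carr G \<Longrightarrow> b \<in> I 0 \<Longrightarrow> brk G x b \<in> I 0"
      and I1: "V.subspace (I 1)"
      using ds n by (auto simp: direct_sum_of_ideals_def lie_ideal_def)
    have "I 0 = {0} \<or> B = {0}"
      by (rule indecomposable[OF A(1,2) B(2-5,7)]) (blast intro: A(3) B(6) subsetD[OF A(2)] subsetD[OF B(3)])+
    then show False
    proof
      assume "B = {0}"
      then have "I 1 = {0}" using B(1) V.subspace_0[OF I1] by blast
      then show False using ne n by auto
    qed (use ne n in auto)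
  qed
  then show ?thesis using completable_G unfolding simple_completable_def by blast
qed

end
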